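(* Let $Z_0$ be the zero cell of the stationary Poisson-Voronoi mosaic associated to a stationary Poisson point process $N$ with intensity $\lambda$ in $\mathbb{R}^n$. Let $Y$ be a random vector such that, conditioned on $Z_0$, $Y\sim\mathrm{Uniform}(Z_0-c(Z_0))$. Then $Y$ has the log-concave density $$f_Y(x)=\lambda e^{-\lambda\kappa_n|x|^n},$$ and for all $k\in\mathbb{N}$, $$\mathbb{E}[|Y|^k]=\frac{\Gamma\left(1+\frac kn\right)}{(\lambda\kappa_n)^{k/n}}.$$
   Context: $|\cdot|$ is the Euclidean norm and $\kappa_n=\pi^{n/2}/\Gamma(n/2+1)$ is the volume of the unit ball in $\mathbb{R}^n$. Let $N$ be a stationary Poisson point process in $\mathbb{R}^n$ with intensity $\lambda\in(0,\infty)$. For $x\in N$ the Voronoi cell with center $x$ is $C(x,N)=\{z\in\mathbb{R}^n: |z-x|\le|z-y|\text{ for all }y\in N\}$. The collection $\{C(x,N):x\in N\}$ is the stationary Poisson-Voronoi mosaic induced by $N$. The center function $c$ assigns to a cell $C(x,N)$ its associated point $x\in N$, i.e. $c(C(x,N))=x$. The zero cell is the (almost surely unique) cell containing the origin. "Conditioned on $Z_0$, $Y\sim\mathrm{Uniform}(Z_0-c(Z_0))$" means that, given the mosaic, $Y$ has the uniform distribution (normalized Lebesgue measure) on the translated cell $Z_0-c(Z_0)$. A density is log-concave if its logarithm is a concave function. *)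

theory Defs
  imports "HOL-Probability.Probability"
begin

text \<open>
  A point process is a map from a probability space \<open>M\<close> to locally finite subsets of the Euclidean
  space; this loses no generality for Poisson processes with diffuse intensity, which are simple.
  A stationary Poisson process of intensity \<open>l\<close> is the Poisson process with intensity measure
  \<open>l\<close> times Lebesgue measure (translation invariance is a consequence).  The Poisson weights are
  written out because \<open>poisson_pmf\<close> is unspecified at rate 0, which occurs for null sets \<open>B\<close>.
\<close>

definition stationary_poisson_process ::
    "'w measure \<Rightarrow> real \<Rightarrow> ('w \<Rightarrow> 'a::euclidean_space set) \<Rightarrow> bool" where
  "stationary_poisson_process M l N \<longleftrightarrow>
     (\<forall>\<omega>\<in>space M. \<forall>B. bounded B \<longrightarrow> finite (N \<omega> \<inter> B)) \<and>
     (\<forall>B. B \<in> sets borel \<and> bounded B \<longrightarrow>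
        (\<lambda>\<omega>. card (N \<omega> \<inter> B)) \<in> measurable M (count_space UNIV) \<and>
        (\<forall>j. measure M {\<omega>\<in>space M. card (N \<omega> \<inter> B) = j} =
              (l * measure lborel B) ^ j / fact j * exp (- (l * measure lborel B)))) \<and>
     (\<forall>(m::nat) B. (\<forall>i<m. B i \<in> sets borel \<and> bounded (B i)) \<and> disjoint_family_on B {..<m} \<longrightarrow>
        prob_space.indep_vars M (\<lambda>_. count_space UNIV) (\<lambda>i \<omega>. card (N \<omega> \<inter> B i)) {..<m})"

definition voronoi_cell :: "'a::euclidean_space \<Rightarrow> 'a set \<Rightarrow> 'a set" where
  "voronoi_cell x P = {z. \<forall>y\<in>P. dist z x \<le> dist z y}"

definition voronoi_mosaic :: "'a::euclidean_space set \<Rightarrow> 'a set set" where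
  "voronoi_mosaic P = (\<lambda>x. voronoi_cell x P) ` P"

text \<open>
  Distinct points of \<open>P\<close> have distinct cells, so the description below is proper for every cell of
  the mosaic.  The set \<open>P\<close> is an argument because a cell alone does not determine its center.
\<close>

definition cell_center :: "'a::euclidean_space set \<Rightarrow> 'a set \<Rightarrow> 'a" where
  "cell_center P C = (THE x. x \<in> P \<and> C = voronoi_cell x P)"

text \<open>
  Unspecified on the null event that the origin lies in no cell or in several cells.
\<close>

definition zero_cell :: "'a::euclidean_space set \<Rightarrow> 'a set" where
  "zero_cell P = (THE C. C \<in> voronoi_mosaic P \<and> 0 \<in> C)"

text \<open>
  The information contained in the mosaic together with its centers is that contained in the
  point process: the sigma-algebra generated by all counting variables.
\<close>

definition process_algebra :: "'w measure \<Rightarrow> ('w \<Rightarrow> 'a::euclidean_space set) \<Rightarrow> 'w measure" where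
  "process_algebra M N =
     sigma (space M) {{\<omega>\<in>space M. card (N \<omega> \<inter> B) = j} | B (j::nat). B \<in> sets borel \<and> bounded B}"

text \<open>
  Given the sub-sigma-algebra \<open>F\<close>, the random vector \<open>Y\<close> is uniformly distributed on the random
  set \<open>S\<close>.
\<close>

definition conditionally_uniform ::
    "'w measure \<Rightarrow> 'w measure \<Rightarrow> ('w \<Rightarrow> 'a::euclidean_space) \<Rightarrow> ('w \<Rightarrow> 'a set) \<Rightarrow> bool" where
  "conditionally_uniform M F Y S \<longleftrightarrow>
     Y \<in> borel_measurable M \<and>
     (\<forall>B\<in>sets borel. AE \<omega> in M.
        real_cond_exp M F (indicat_real (Y -` B \<inter> space M)) \<omega> =
        measure (uniform_measure lborel (S \<omega>)) B)"

text \<open>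
  Concavity of the extended-valued logarithm, with value minus infinity where \<open>f\<close> vanishes
  (Isabelle's \<open>ln 0 = 0\<close> would be wrong there); \<open>concave_on\<close> includes convexity of the support.
\<close>

definition log_concave :: "('a::real_vector \<Rightarrow> real) \<Rightarrow> bool" where
  "log_concave f \<longleftrightarrow> (\<forall>x. 0 \<le> f x) \<and> concave_on {x. 0 < f x} (\<lambda>x. ln (f x))"

end

theory Submission
  imports Defs
begin

text \<open>
  Let \<open>C(P)\<close> be the Voronoi cell of the origin with respect to \<open>P\<close>.  Almost surely
  the zero cell has exactly one center \<open>x\<close>, so \<open>P(Y \<in> B)\<close> is the expectation of the
  sum over \<open>x \<in> N\<close> of \<open>1{-x \<in> C(N - x)} vol(B \<inter> C(N - x)) / vol C(N - x)\<close>.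
  By stationarity (mass transport) this equals, up to the factor \<open>vol A\<close>, the expectation of the
  sum over \<open>y \<in> N \<inter> A\<close> of the same expression with \<open>-x\<close> integrated over space, where it
  becomes \<open>vol(B \<inter> C(N - y))\<close>, the integral over \<open>z \<in> B\<close> of
  \<open>1{z \<in> C(N - y)}\<close>.  For \<open>A\<close> the ball of radius \<open>e\<close> around the origin,
  \<open>z \<in> C(N - y)\<close> forces the ball of radius \<open>|z| - e\<close> around \<open>z\<close>, which is disjoint
  from \<open>A\<close>, to be free of points; independence and \<open>e \<rightarrow> 0\<close> give
  \<open>P(Y \<in> B) \<le> \<integral> f over B\<close>.  Only this inequality is needed: since \<open>f\<close> has total mass 1,
  equality follows by passing to complements, and no Palm or Mecke theory is required.  The inequality
  also makes it unnecessary to know that cells have finite volume, as division by infinity gives 0.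
\<close>

section \<open>Locally finite configurations\<close>

definition locally_finite :: "'a::metric_space set \<Rightarrow> bool" where
  "locally_finite P \<longleftrightarrow> (\<forall>B. bounded B \<longrightarrow> finite (P \<inter> B))"

text \<open>With the standard sigma-algebra generated by the counts of bounded Borel sets, a point
  process becomes a single random element, so that its law is a measure that can be shifted and
  integrated against.\<close>

definition configurations :: "'a::euclidean_space set measure" where
  "configurations = sigma (Collect locally_finite)
     {{P. locally_finite P \<and> card (P \<inter> B) = j} | B (j::nat). B \<in> sets borel \<and> bounded B}"

lemma space_configurations: "space configurations = Collect locally_finite"
  unfolding configurations_def by (rule space_measure_of) auto

lemma sets_configurations:
  "sets (configurations :: 'a::euclidean_space set measure) =
     sigma_sets (Collect locally_finite)
       {{P. locally_finite P \<and> card (P \<inter> B) = j} | B (j::nat). B \<in> sets borel \<and> bounded B}"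
  unfolding configurations_def by (rule sets_measure_of) auto

lemma measurable_card_configurations:
  fixes B :: "'a::euclidean_space set"
  assumes "B \<in> sets borel" "bounded B"
  shows "(\<lambda>P. card (P \<inter> B)) \<in> measurable configurations (count_space UNIV)"
proof (subst measurable_count_space_eq2_countable, safe)
  fix j
  have "(\<lambda>P. card (P \<inter> B)) -` {j} \<inter> space configurations = {P. locally_finite P \<and> card (P \<inter> B) = j}"
    by (auto simp: space_configurations)
  also have "\<dots> \<in> sets configurations"
    unfolding sets_configurations using assms by (intro sigma_sets.Basic) auto
  finally show "(\<lambda>P. card (P \<inter> B)) -` {j} \<inter> space configurations \<in> sets configurations" .
qed auto

lemma measurable_configurationsI:
  fixes N :: "'w \<Rightarrow> 'a::euclidean_space set"
  assumes "\<And>\<omega>. \<omega> \<in> space M \<Longrightarrow> locally_finite (N \<omega>)"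
    and *: "\<And>B. B \<in> sets borel \<Longrightarrow> bounded B \<Longrightarrow>
          (\<lambda>\<omega>. card (N \<omega> \<inter> B)) \<in> measurable M (count_space UNIV)"
  shows "N \<in> measurable M configurations"
  unfolding configurations_def
proof (rule measurable_measure_of)
  fix A assume "A \<in> {{P. locally_finite P \<and> card (P \<inter> B) = j} | (B :: 'a set) (j::nat).
      B \<in> sets borel \<and> bounded B}"
  then obtain B j where A: "A = {P. locally_finite P \<and> card (P \<inter> B) = j}" "B \<in> sets borel" "bounded B"
    by auto
  have "N -` A \<inter> space M = (\<lambda>\<omega>. card (N \<omega> \<inter> B)) -` {j} \<inter> space M"
    using assms(1) by (auto simp: A)
  then show "N -` A \<inter> space M \<in> sets M"
    using measurable_sets[OF *[OF A(2,3)], of "{j}"] by simp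
qed (use assms(1) in auto)

lemma locally_finite_ball:
  fixes P :: "'a::euclidean_space set"
  shows "locally_finite P \<Longrightarrow> finite (P \<inter> ball x r)"
  by (auto simp: locally_finite_def)

lemma UN_ball_nat: "(\<Union>r::nat. ball (0::'a::real_normed_vector) (real r)) = UNIV"
  using reals_Archimedean2 by auto

lemma countable_locally_finite:
  fixes P :: "'a::euclidean_space set"
  assumes "locally_finite P"
  shows "countable P"
proof -
  have "P = (\<Union>r::nat. P \<inter> ball 0 (real r))"
    using UN_ball_nat by blast
  then show ?thesis
    using assms by (metis countable_UN countable_finite countableI_type locally_finite_ball)
qed

lemma emeasure_count_space_distr:
  fixes P :: "'a::euclidean_space set"
  assumes "finite P" "B \<in> sets borel"
  shows "emeasure (distr (count_space P) borel (\<lambda>x. x)) B = of_nat (card (P \<inter> B))"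
proof -
  have "emeasure (distr (count_space P) borel (\<lambda>x. x)) B = emeasure (count_space P) (P \<inter> B)"
    using assms by (subst emeasure_distr) (auto simp: Int_commute)
  also have "\<dots> = of_nat (card (P \<inter> B))"
    using assms by (subst emeasure_count_space) auto
  finally show ?thesis .
qed

text \<open>
  The counting measure of a bounded part of the configuration, divided by one plus its mass, is a
  subprobability kernel, which gives access to the measurability theory of the Giry monad.
\<close>
lemma measurable_nn_integral_points:
  fixes N :: "'w \<Rightarrow> 'a::euclidean_space set"
  assumes N: "N \<in> measurable M configurations"
    and G: "(\<lambda>(\<omega>, x). G \<omega> x) \<in> borel_measurable (M \<Otimes>\<^sub>M borel)"
  shows "(\<lambda>\<omega>. \<integral>\<^sup>+x. G \<omega> x \<partial>count_space (N \<omega>)) \<in> borel_measurable M"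
proof -
  define c where "c r \<omega> = (of_nat (card (N \<omega> \<inter> ball 0 (real r))) :: ennreal)" for r :: nat and \<omega>
  define L where "L r \<omega> = scale_measure (inverse (1 + c r \<omega>))
     (distr (count_space (N \<omega> \<inter> ball 0 (real r))) borel (\<lambda>x. x))" for r :: nat and \<omega>
  have lf: "locally_finite (N \<omega>)" if "\<omega> \<in> space M" for \<omega>
    using measurable_space[OF N that] by (simp add: space_configurations)
  have cm[measurable]: "(\<lambda>\<omega>. of_nat (card (N \<omega> \<inter> B)) :: ennreal) \<in> borel_measurable M"
    if "B \<in> sets borel" "bounded B" for B
    using measurable_compose[OF measurable_compose[OF N measurable_card_configurations[OF that]],
        of of_nat borel] by simp
  have c[measurable]: "c r \<in> borel_measurable M" for r
    unfolding c_def by (rule cm) auto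
  have eL: "emeasure (L r \<omega>) B = inverse (1 + c r \<omega>) * of_nat (card (N \<omega> \<inter> (ball 0 (real r) \<inter> B)))"
    if "\<omega> \<in> space M" "B \<in> sets borel" for r \<omega> B
    unfolding L_def using locally_finite_ball[OF lf[OF that(1)], of 0 "real r"] that(2)
    by (simp add: emeasure_count_space_distr Int_assoc)
  \<comment> \<open>Adding 1 keeps the normalising constant positive even for an empty ball, so the
    normalisation can be undone after integrating.\<close>
  have inv: "inverse (1 + c r \<omega>) * (1 + c r \<omega>) = 1" for r \<omega>
  proof -
    have "1 + c r \<omega> \<noteq> 0" "1 + c r \<omega> < top"
      by (auto simp: c_def of_nat_less_top)
    then show ?thesis
      by (metis ennreal_divide_self divide_ennreal_def mult.commute)
  qed
  have L: "L r \<in> measurable M (subprob_algebra borel)" for r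
  proof (rule measurable_subprob_algebra)
    fix \<omega> assume \<omega>: "\<omega> \<in> space M"
    have [simp]: "space (L r \<omega>) = UNIV" by (simp add: L_def space_scale_measure)
    show "sets (L r \<omega>) = sets borel" by (simp add: L_def)
    show "subprob_space (L r \<omega>)"
    proof
      have "emeasure (L r \<omega>) (space (L r \<omega>)) = inverse (1 + c r \<omega>) * c r \<omega>"
        using \<omega> by (simp add: eL c_def)
      also have "\<dots> \<le> inverse (1 + c r \<omega>) * (1 + c r \<omega>)"
        by (intro mult_left_mono) auto
      finally show "emeasure (L r \<omega>) (space (L r \<omega>)) \<le> 1"
        by (simp add: inv)
    qed simp
  next
    fix B :: "'a set" assume B: "B \<in> sets borel"
    have "(\<lambda>\<omega>. inverse (1 + c r \<omega>) * of_nat (card (N \<omega> \<inter> (ball 0 (real r) \<inter> B)))) \<in> borel_measurable M"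
      using B by (intro borel_measurable_times_ennreal cm) (measurable, auto)
    then show "(\<lambda>\<omega>. emeasure (L r \<omega>) B) \<in> borel_measurable M"
      by (rule measurable_cong[THEN iffD2, rotated]) (simp add: eL B)
  qed
  have IL: "(\<lambda>\<omega>. integral\<^sup>N (L r \<omega>) (G \<omega>)) \<in> borel_measurable M" for r
    by (rule nn_integral_measurable_subprob_algebra2[OF G L])
  have "(\<integral>\<^sup>+x. G \<omega> x \<partial>count_space (N \<omega>)) = (SUP r. (1 + c r \<omega>) * integral\<^sup>N (L r \<omega>) (G \<omega>))"
    if \<omega>: "\<omega> \<in> space M" for \<omega>
  proof -
    have Gm[measurable]: "G \<omega> \<in> borel_measurable borel"
      using measurable_compose[OF measurable_Pair1'[OF \<omega>] G] by simp
    \<comment> \<open>Multiplying back by the measurable mass leaves the sum over the points in the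
      ball; the increasing balls then give the whole sum by monotone convergence.\<close>
    have "(1 + c r \<omega>) * integral\<^sup>N (L r \<omega>) (G \<omega>) =
        (\<integral>\<^sup>+x. G \<omega> x * indicator (ball 0 (real r)) x \<partial>count_space (N \<omega>))" for r
    proof -
      have "integral\<^sup>N (L r \<omega>) (G \<omega>) =
          inverse (1 + c r \<omega>) * (\<integral>\<^sup>+x. G \<omega> x \<partial>count_space (N \<omega> \<inter> ball 0 (real r)))"
        unfolding L_def by (subst nn_integral_scale_measure) (simp_all add: nn_integral_distr)
      moreover have "(\<integral>\<^sup>+x. G \<omega> x \<partial>count_space (N \<omega> \<inter> ball 0 (real r))) =
          (\<integral>\<^sup>+x. G \<omega> x * indicator (ball 0 (real r)) x \<partial>count_space (N \<omega>))"
        by (subst (1 2) nn_integral_count_space_indicator)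
           (auto intro!: nn_integral_cong simp: indicator_def)
      ultimately show ?thesis
        using inv[of r \<omega>] by (simp add: mult.assoc[symmetric] mult.commute[of "1 + c r \<omega>"])
    qed
    then have "(SUP r. (1 + c r \<omega>) * integral\<^sup>N (L r \<omega>) (G \<omega>)) =
        (SUP r. \<integral>\<^sup>+x. G \<omega> x * indicator (ball 0 (real r)) x \<partial>count_space (N \<omega>))"
      by simp
    also have "\<dots> = (\<integral>\<^sup>+x. (SUP r. G \<omega> x * indicator (ball 0 (real r)) x) \<partial>count_space (N \<omega>))"
      by (rule nn_integral_monotone_convergence_SUP[symmetric])
         (auto simp: incseq_def le_fun_def indicator_def)
    also have "\<dots> = (\<integral>\<^sup>+x. G \<omega> x \<partial>count_space (N \<omega>))"
    proof (intro nn_integral_cong antisym SUP_least)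
      fix x :: 'a
      obtain r :: nat where "x \<in> ball 0 (real r)"
        using UN_ball_nat by blast
      then show "G \<omega> x \<le> (SUP r. G \<omega> x * indicator (ball 0 (real r)) x)"
        by (intro SUP_upper2[of r]) auto
      show "G \<omega> x * indicator (ball 0 (real r)) x \<le> G \<omega> x" for r :: nat
        by (simp add: indicator_def)
    qed
    finally show ?thesis ..
  qed
  then show ?thesis
    using IL by (subst measurable_cong) measurable
qed

lemma nn_integral_indicator_points:
  assumes "finite (P \<inter> B)"
  shows "(\<integral>\<^sup>+x. indicator B x \<partial>count_space P) = of_nat (card (P \<inter> B))"
proof -
  have "(\<integral>\<^sup>+x. indicator B x \<partial>count_space P) = (\<integral>\<^sup>+x. indicator (P \<inter> B) x \<partial>count_space P)"
    by (auto intro!: nn_integral_cong simp: indicator_def)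
  also have "\<dots> = of_nat (card (P \<inter> B))"
    using assms by (subst nn_integral_indicator) auto
  finally show ?thesis .
qed

section \<open>Translation of configurations\<close>

lemma locally_finite_translate:
  fixes P :: "'a::euclidean_space set"
  assumes "locally_finite P"
  shows "locally_finite ((\<lambda>y. y - x) ` P)"
  unfolding locally_finite_def
proof safe
  fix B :: "'a set" assume "bounded B"
  then have "finite (P \<inter> (\<lambda>y. x + y) ` B)"
    using assms by (simp add: locally_finite_def bounded_translation)
  then have "finite ((\<lambda>y. y - x) ` (P \<inter> (\<lambda>y. x + y) ` B))" by simp
  moreover have "(\<lambda>y. y - x) ` P \<inter> B \<subseteq> (\<lambda>y. y - x) ` (P \<inter> (\<lambda>y. x + y) ` B)"
    by (force simp: image_iff)
  ultimately show "finite ((\<lambda>y. y - x) ` P \<inter> B)" by (rule finite_subset[rotated])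
qed

lemma nn_integral_translate_points:
  fixes x :: "'a::euclidean_space"
  shows "(\<integral>\<^sup>+y. F y \<partial>count_space ((\<lambda>y. y - x) ` P)) = (\<integral>\<^sup>+y. F (y - x) \<partial>count_space P)"
  by (rule nn_integral_bij_count_space[symmetric]) (auto simp: bij_betw_def inj_on_def)

text \<open>A count of shifted points is the integral over the original points of an indicator that
  is jointly measurable in shift and point, so \<open>measurable_nn_integral_points\<close>
  applies.\<close>

lemma measurable_translate_configurations:
  "(\<lambda>(x, P). (\<lambda>y. y - x) ` P) \<in>
     measurable (borel \<Otimes>\<^sub>M configurations) (configurations :: 'a::euclidean_space set measure)"
proof (rule measurable_configurationsI)
  fix B :: "'a set" assume B: "B \<in> sets borel" "bounded B"
  have [measurable]: "B \<in> sets borel" by fact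
  have lf: "locally_finite (snd w)" if "w \<in> space (borel \<Otimes>\<^sub>M configurations)" for w :: "'a \<times> 'a set"
    using that by (auto simp: space_pair_measure space_configurations)
  have "(\<lambda>w :: 'a \<times> 'a set. \<integral>\<^sup>+y. indicator B (y - fst w) \<partial>count_space (snd w))
      \<in> borel_measurable (borel \<Otimes>\<^sub>M configurations)"
    by (rule measurable_nn_integral_points) measurable
  then have m: "(\<lambda>w :: 'a \<times> 'a set. of_nat (card ((\<lambda>y. y - fst w) ` snd w \<inter> B)) :: ennreal)
      \<in> borel_measurable (borel \<Otimes>\<^sub>M configurations)"
  proof (rule measurable_cong[THEN iffD2, rotated])
    fix w :: "'a \<times> 'a set" assume "w \<in> space (borel \<Otimes>\<^sub>M configurations)"
    then have "finite ((\<lambda>y. y - fst w) ` snd w \<inter> B)"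
      using locally_finite_translate[OF lf] B by (auto simp: locally_finite_def)
    then show "of_nat (card ((\<lambda>y. y - fst w) ` snd w \<inter> B)) =
        (\<integral>\<^sup>+y. indicator B (y - fst w) \<partial>count_space (snd w))"
      by (simp add: nn_integral_translate_points[symmetric] nn_integral_indicator_points)
  qed
  show "(\<lambda>w. card ((case w of (x, P) \<Rightarrow> (\<lambda>y. y - x) ` P) \<inter> B))
      \<in> measurable (borel \<Otimes>\<^sub>M configurations) (count_space UNIV)"
  proof (subst measurable_count_space_eq2_countable, safe)
    fix j :: nat
    \<comment> \<open>Since \<open>of_nat\<close> is injective into \<open>ennreal\<close>, the
      level sets of the integer count can be read off from its extended real version.\<close>
    have "{w \<in> space (borel \<Otimes>\<^sub>M configurations).
        (of_nat (card ((\<lambda>y. y - fst w) ` snd w \<inter> B)) :: ennreal) = of_nat j}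
        \<in> sets (borel \<Otimes>\<^sub>M configurations)"
      using m by measurable
    also have "{w \<in> space (borel \<Otimes>\<^sub>M configurations).
        (of_nat (card ((\<lambda>y. y - fst w) ` snd w \<inter> B)) :: ennreal) = of_nat j} =
        (\<lambda>w. card ((case w of (x, P) \<Rightarrow> (\<lambda>y. y - x) ` P) \<inter> B)) -` {j} \<inter>
          space (borel \<Otimes>\<^sub>M configurations)"
      by (auto simp: case_prod_beta)
    finally show "\<dots> \<in> sets (borel \<Otimes>\<^sub>M configurations)" .
  qed auto
qed (auto simp: space_pair_measure space_configurations locally_finite_translate)

section \<open>Uniqueness and stationarity of the Poisson law\<close>

lemma
  fixes N :: "'w \<Rightarrow> 'a::euclidean_space set"
  assumes "stationary_poisson_process M l N"
  shows poisson_locally_finite: "\<omega> \<in> space M \<Longrightarrow> locally_finite (N \<omega>)"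
    and poisson_measurable_card: "B \<in> sets borel \<Longrightarrow> bounded B \<Longrightarrow>
          (\<lambda>\<omega>. card (N \<omega> \<inter> B)) \<in> measurable M (count_space UNIV)"
    and poisson_card_prob: "B \<in> sets borel \<Longrightarrow> bounded B \<Longrightarrow>
          measure M {\<omega>\<in>space M. card (N \<omega> \<inter> B) = j} =
              (l * measure lborel B) ^ j / fact j * exp (- (l * measure lborel B))"
proof -
  note N = assms[unfolded stationary_poisson_process_def]
  show "\<omega> \<in> space M \<Longrightarrow> locally_finite (N \<omega>)"
    using conjunct1[OF N] by (simp add: locally_finite_def)
  show "B \<in> sets borel \<Longrightarrow> bounded B \<Longrightarrow> (\<lambda>\<omega>. card (N \<omega> \<inter> B)) \<in> measurable M (count_space UNIV)"
    "B \<in> sets borel \<Longrightarrow> bounded B \<Longrightarrow> measure M {\<omega>\<in>space M. card (N \<omega> \<inter> B) = j} =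
              (l * measure lborel B) ^ j / fact j * exp (- (l * measure lborel B))"
    using conjunct1[OF conjunct2[OF N]] by simp_all
qed

lemma poisson_indep:
  fixes N :: "'w \<Rightarrow> 'a::euclidean_space set" and C :: "nat \<Rightarrow> 'a set"
  assumes N: "stationary_poisson_process M l N"
    and C: "\<And>i. i < m \<Longrightarrow> C i \<in> sets borel" "\<And>i. i < m \<Longrightarrow> bounded (C i)"
      "disjoint_family_on C {..<m}"
  shows "prob_space.indep_vars M (\<lambda>_. count_space UNIV) (\<lambda>i \<omega>. card (N \<omega> \<inter> C i)) {..<m}"
proof -
  have "(\<forall>i<m. C i \<in> sets borel \<and> bounded (C i)) \<and> disjoint_family_on C {..<m}"
    using C by auto
  then show ?thesis
    by (rule mp[OF spec[OF spec[OF conjunct2[OF conjunct2[OF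
      N[unfolded stationary_poisson_process_def]]]]]])
qed

lemma poisson_measurable:
  "stationary_poisson_process M l N \<Longrightarrow> N \<in> measurable M configurations"
  by (intro measurable_configurationsI poisson_locally_finite poisson_measurable_card)

text \<open>Independence over disjoint sets makes the joint law the product of the one-set laws, and
  each of these has Poisson weights fixed by \<open>l\<close> and the volume.\<close>

lemma poisson_joint_law_unique:
  fixes N :: "'w \<Rightarrow> 'a::euclidean_space set" and N' :: "'v \<Rightarrow> 'a set" and C :: "nat \<Rightarrow> 'a set"
  assumes M: "prob_space M" "prob_space M'"
    and N: "stationary_poisson_process M l N" "stationary_poisson_process M' l N'"
    and C: "\<And>i. i < m \<Longrightarrow> C i \<in> sets borel" "\<And>i. i < m \<Longrightarrow> bounded (C i)"
      "disjoint_family_on C {..<m}" and "0 < m"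
  shows "distr M (Pi\<^sub>M {..<m} (\<lambda>_. count_space UNIV)) (\<lambda>\<omega>. \<lambda>i\<in>{..<m}. card (N \<omega> \<inter> C i)) =
         distr M' (Pi\<^sub>M {..<m} (\<lambda>_. count_space UNIV)) (\<lambda>\<omega>. \<lambda>i\<in>{..<m}. card (N' \<omega> \<inter> C i))"
    (is "?L = ?R")
proof -
  interpret M: prob_space M by fact
  interpret M': prob_space M' by fact
  have ne: "{..<m} \<noteq> {}" using \<open>0 < m\<close> by auto
  have eq: "distr M (count_space UNIV) (\<lambda>\<omega>. card (N \<omega> \<inter> C i)) =
      distr M' (count_space UNIV) (\<lambda>\<omega>. card (N' \<omega> \<inter> C i))" if "i < m" for i
  proof (rule measure_eqI_countable[where A = UNIV])
    fix j :: nat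
    have vim: "(\<lambda>\<omega>. card (X \<omega> \<inter> C i)) -` {j} \<inter> space K = {\<omega> \<in> space K. card (X \<omega> \<inter> C i) = j}"
      for X :: "'u \<Rightarrow> 'a set" and K
      by auto
    show "emeasure (distr M (count_space UNIV) (\<lambda>\<omega>. card (N \<omega> \<inter> C i))) {j} =
        emeasure (distr M' (count_space UNIV) (\<lambda>\<omega>. card (N' \<omega> \<inter> C i))) {j}"
      using that C(1,2)
      by (simp add: emeasure_distr poisson_measurable_card[OF N(1)] poisson_measurable_card[OF N(2)]
          vim M.emeasure_eq_measure M'.emeasure_eq_measure poisson_card_prob[OF N(1)]
          poisson_card_prob[OF N(2)])
  qed auto
  have "?L = (\<Pi>\<^sub>M i\<in>{..<m}. distr M (count_space UNIV) (\<lambda>\<omega>. card (N \<omega> \<inter> C i)))"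
    by (rule M.indep_vars_iff_distr_eq_PiM'[THEN iffD1, OF ne _ poisson_indep[OF N(1) C]])
       (auto intro!: poisson_measurable_card[OF N(1)] C)
  also have "\<dots> = (\<Pi>\<^sub>M i\<in>{..<m}. distr M' (count_space UNIV) (\<lambda>\<omega>. card (N' \<omega> \<inter> C i)))"
    by (rule PiM_cong) (auto simp: eq)
  also have "\<dots> = ?R"
    by (rule M'.indep_vars_iff_distr_eq_PiM'[THEN iffD1, OF ne _ poisson_indep[OF N(2) C], symmetric])
       (auto intro!: poisson_measurable_card[OF N(2)] C)
  finally show ?thesis .
qed

text \<open>
  Overlapping sets are handled by passing to the atoms of the finite algebra they generate, indexed by
  the set of those \<open>i\<close> for which the atom lies inside \<open>B i\<close>.
\<close>
lemma poisson_count_law_unique: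
  fixes N :: "'w \<Rightarrow> 'a::euclidean_space set" and N' :: "'v \<Rightarrow> 'a set"
    and m :: nat and k :: "nat \<Rightarrow> nat"
  assumes M: "prob_space M" "prob_space M'"
    and N: "stationary_poisson_process M l N" "stationary_poisson_process M' l N'"
    and B: "\<And>i. i < m \<Longrightarrow> B i \<in> sets borel" "\<And>i. i < m \<Longrightarrow> bounded (B i)"
  shows "emeasure M {\<omega>\<in>space M. \<forall>i<m. card (N \<omega> \<inter> B i) = k i} =
         emeasure M' {\<omega>\<in>space M'. \<forall>i<m. card (N' \<omega> \<inter> B i) = k i}"
proof -
  \<comment> \<open>Independence is stated for families indexed by naturals, so \<open>h\<close>
    numbers the subsets of \<open>{..<m}\<close>, one candidate atom for each.\<close>
  define K where "K = card (Pow {..<m})"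
  obtain h where h: "bij_betw h {..<K} (Pow {..<m})"
    unfolding K_def using ex_bij_betw_nat_finite[of "Pow {..<m}"] by (auto simp: atLeast0LessThan)
  \<comment> \<open>Restricting to the union makes the atom of the empty index set empty; otherwise
    it would be the unbounded complement of all the \<open>B i\<close>.\<close>
  define C where "C j = {x \<in> (\<Union>i<m. B i). {i. i < m \<and> x \<in> B i} = h j}" for j
  have "0 < K" by (simp add: K_def card_Pow)
  have Cb: "bounded (C j)" for j
    by (rule bounded_subset[of "\<Union>i<m. B i"]) (auto simp: C_def B)
  have Cm: "C j \<in> sets borel" for j
  \<comment> \<open>Outside \<open>{..<K}\<close> the map \<open>h\<close> is arbitrary, so
    \<open>h j\<close> may contain indices that are not below \<open>m\<close>; no point has such an
    index set.\<close>
  proof (cases "h j \<subseteq> {..<m}")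
    case True
    then have "C j = (\<Union>i<m. B i) \<inter> (\<Inter>i\<in>h j. B i) \<inter> - (\<Union>i\<in>{..<m} - h j. B i)"
      unfolding C_def by (auto simp: set_eq_iff)
    moreover have "(\<Inter>i\<in>h j. B i) \<in> sets borel"
      using True finite_subset[OF True] B(1)
      by (cases "h j = {}") (auto intro!: sets.finite_INT)
    ultimately show ?thesis
      using B(1) by (auto intro!: sets.Int sets.finite_UN borel_comp)
  next
    case False
    then have "C j = {}" unfolding C_def by auto
    then show ?thesis by simp
  qed
  have Cd: "disjoint_family_on C {..<K}"
    using bij_betw_imp_inj_on[OF h] unfolding disjoint_family_on_def C_def inj_on_def by fastforce
  have split: "card (P \<inter> B i) = (\<Sum>j<K. if i \<in> h j then card (P \<inter> C j) else 0)"
    if "i < m" "locally_finite P" for i and P :: "'a set"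
  proof -
    have "P \<inter> B i = (\<Union>j\<in>{j. j < K \<and> i \<in> h j}. P \<inter> C j)"
    proof (intro subset_antisym subsetI)
      fix x assume x: "x \<in> P \<inter> B i"
      have "{i. i < m \<and> x \<in> B i} \<in> h ` {..<K}"
        using bij_betw_imp_surj_on[OF h] by auto
      then obtain j where "j < K" "{i. i < m \<and> x \<in> B i} = h j" by auto
      with x \<open>i < m\<close> show "x \<in> (\<Union>j\<in>{j. j < K \<and> i \<in> h j}. P \<inter> C j)"
        by (auto simp: C_def)
    qed (auto simp: C_def)
    also have "card \<dots> = (\<Sum>j\<in>{j. j < K \<and> i \<in> h j}. card (P \<inter> C j))"
      using Cd that(2) Cb
      by (intro card_UN_disjoint) (auto simp: disjoint_family_on_def locally_finite_def)
    also have "\<dots> = (\<Sum>j<K. if i \<in> h j then card (P \<inter> C j) else 0)"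
      by (subst sum.If_cases) (auto intro!: sum.cong)
    finally show ?thesis .
  qed
  let ?PK = "Pi\<^sub>M {..<K} (\<lambda>_. count_space UNIV) :: (nat \<Rightarrow> nat) measure"
  \<comment> \<open>Counts of the \<open>B i\<close> are sums of atom counts, so the event about the
    \<open>B i\<close> is the preimage of \<open>S\<close> under the vector of atom counts.\<close>
  define S where "S = {g \<in> space ?PK. \<forall>i<m. (\<Sum>j<K. if i \<in> h j then g j else 0) = k i}"
  have S: "S \<in> sets ?PK"
  proof -
    have [measurable]: "(\<lambda>g. \<Sum>j<K. if i \<in> h j then g j else 0) \<in> measurable ?PK (count_space UNIV)" for i
      by (rule measurable_sum_nat) auto
    show ?thesis unfolding S_def by measurable
  qed
  have red: "emeasure W {\<omega>\<in>space W. \<forall>i<m. card (X \<omega> \<inter> B i) = k i} =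
      emeasure (distr W ?PK (\<lambda>\<omega>. \<lambda>j\<in>{..<K}. card (X \<omega> \<inter> C j))) S"
    if X: "stationary_poisson_process W l X" for W :: "'u measure" and X
  proof -
    have "(\<lambda>\<omega>. \<lambda>j\<in>{..<K}. card (X \<omega> \<inter> C j)) \<in> measurable W ?PK"
      by (intro measurable_restrict poisson_measurable_card[OF X] Cm Cb)
    moreover have "{\<omega>\<in>space W. \<forall>i<m. card (X \<omega> \<inter> B i) = k i} =
        (\<lambda>\<omega>. \<lambda>j\<in>{..<K}. card (X \<omega> \<inter> C j)) -` S \<inter> space W"
      using poisson_locally_finite[OF X]
      by (auto simp: S_def split space_PiM cong: if_cong)
    ultimately show ?thesis using S by (simp add: emeasure_distr)
  qed
  show ?thesis
    unfolding red[OF N(1)] red[OF N(2)]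
    using poisson_joint_law_unique[OF M N Cm Cb Cd \<open>0 < K\<close>] by simp
qed

text \<open>Cylinder events, which prescribe finitely many counts, form an intersection-stable
  generator of the configuration sigma-algebra, and \<open>poisson_count_law_unique\<close> gives
  agreement on them.\<close>

lemma poisson_law_unique:
  fixes N :: "'w \<Rightarrow> 'a::euclidean_space set" and N' :: "'v \<Rightarrow> 'a set"
  assumes M: "prob_space M" "prob_space M'"
    and N: "stationary_poisson_process M l N" "stationary_poisson_process M' l N'"
  shows "distr M configurations N = distr M' configurations N'"
proof -
  interpret M: prob_space M by fact
  interpret M': prob_space M' by fact
  note m = poisson_measurable[OF N(1)] poisson_measurable[OF N(2)]
  define cyl where "cyl m B k = {P. locally_finite P \<and> (\<forall>i<m. card (P \<inter> B i) = k i)}"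
    for m :: nat and B :: "nat \<Rightarrow> 'a set" and k :: "nat \<Rightarrow> nat"
  define E where "E = {cyl m B k | m B k. (\<forall>i<m. B i \<in> sets borel \<and> bounded (B i))}"
  have E_sets: "E \<subseteq> sets configurations"
  proof safe
    fix X assume "X \<in> E"
    then obtain m B k where X: "X = cyl m B k" "\<And>i. i < m \<Longrightarrow> B i \<in> sets borel"
      "\<And>i. i < m \<Longrightarrow> bounded (B i)"
      by (auto simp: E_def)
    have "X = {P \<in> space configurations. \<forall>i\<in>{..<m}. card (P \<inter> B i) = k i}"
      by (auto simp: X cyl_def space_configurations)
    also have "\<dots> \<in> sets configurations"
    proof (rule sets.sets_Collect_finite_All)
      fix i assume "i \<in> {..<m}"
      then have "(\<lambda>P. card (P \<inter> B i)) -` {k i} \<inter> space configurations \<in> sets configurations"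
        by (intro measurable_sets[OF measurable_card_configurations] X) auto
      also have "(\<lambda>P. card (P \<inter> B i)) -` {k i} \<inter> space configurations =
          {P \<in> space configurations. card (P \<inter> B i) = k i}" by auto
      finally show "{P \<in> space configurations. card (P \<inter> B i) = k i} \<in> sets configurations" .
    qed auto
    finally show "X \<in> sets configurations" .
  qed
  have E_gen: "sets configurations = sigma_sets (Collect locally_finite) E"
  proof
    show "sigma_sets (Collect locally_finite) E \<subseteq> sets configurations"
      using sets.sigma_sets_subset[OF E_sets] by (simp add: space_configurations)
    show "sets configurations \<subseteq> sigma_sets (Collect locally_finite) E"
      unfolding sets_configurations
    proof (rule sigma_sets_mono, safe)
      fix B :: "'a set" and j :: nat assume B: "B \<in> sets borel" "bounded B"
      have "{P. locally_finite P \<and> card (P \<inter> B) = j} = cyl 1 (\<lambda>_. B) (\<lambda>_. j)"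
        by (auto simp: cyl_def)
      also have "\<dots> \<in> E" using B by (auto simp: E_def)
      finally show "{P. locally_finite P \<and> card (P \<inter> B) = j} \<in> sigma_sets (Collect locally_finite) E"
        by (rule sigma_sets.Basic)
    qed
  qed
  have "Int_stable E"
  proof (rule Int_stableI)
    fix X Y assume "X \<in> E" "Y \<in> E"
    then obtain m B k m' B' k' where X: "X = cyl m B k" "\<forall>i<m. B i \<in> sets borel \<and> bounded (B i)"
      and Y: "Y = cyl m' B' k'" "\<forall>i<m'. B' i \<in> sets borel \<and> bounded (B' i)"
      unfolding E_def by blast
    \<comment> \<open>Intersecting two cylinders concatenates their constraints. The combined sets
      may overlap, which is why the count laws were compared for arbitrary families.\<close>
    define B'' where "B'' i = (if i < m then B i else B' (i - m))" for i
    define k'' where "k'' i = (if i < m then k i else k' (i - m))" for i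
    have all: "(\<forall>i<m + m'. Q i) \<longleftrightarrow> (\<forall>i<m. Q i) \<and> (\<forall>i<m'. Q (m + i))" for Q
      by (metis add_less_cancel_left le_add_diff_inverse not_less trans_less_add1)
    have "X \<inter> Y = cyl (m + m') B'' k''"
      unfolding X Y cyl_def all by (auto simp: B''_def k''_def)
    moreover have "\<forall>i<m + m'. B'' i \<in> sets borel \<and> bounded (B'' i)"
      unfolding all using X(2) Y(2) by (auto simp: B''_def)
    ultimately show "X \<inter> Y \<in> E"
      unfolding E_def by blast
  qed
  then show ?thesis
  proof (rule measure_eqI_generator_eq[where \<Omega> = "Collect locally_finite" and
        A = "\<lambda>_. Collect locally_finite"])
    fix X assume "X \<in> E"
    with E_sets have Xs: "X \<in> sets configurations" by auto
    from \<open>X \<in> E\<close> obtain m B k where X: "X = cyl m B k" "\<And>i. i < m \<Longrightarrow> B i \<in> sets borel"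
      "\<And>i. i < m \<Longrightarrow> bounded (B i)"
      by (auto simp: E_def)
    have "N -` X \<inter> space M = {\<omega>\<in>space M. \<forall>i<m. card (N \<omega> \<inter> B i) = k i}"
      using poisson_locally_finite[OF N(1)] by (auto simp: X cyl_def)
    moreover have "N' -` X \<inter> space M' = {\<omega>\<in>space M'. \<forall>i<m. card (N' \<omega> \<inter> B i) = k i}"
      using poisson_locally_finite[OF N(2)] by (auto simp: X cyl_def)
    ultimately show "emeasure (distr M configurations N) X = emeasure (distr M' configurations N') X"
      using poisson_count_law_unique[OF M N X(2,3)] by (simp add: emeasure_distr[OF m(1) Xs] emeasure_distr[OF m(2) Xs])
  next
    \<comment> \<open>The cylinder without constraints is the whole space, of mass 1, so a constant
      sequence serves as the exhaustion.\<close>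
    have "Collect locally_finite = cyl 0 (\<lambda>_. {}) (\<lambda>_. 0)" by (simp add: cyl_def)
    then show "range (\<lambda>_::nat. Collect locally_finite) \<subseteq> E" unfolding E_def by blast
    show "emeasure (distr M configurations N) (Collect locally_finite) \<noteq> \<infinity>"
      using prob_space.emeasure_space_1[OF M.prob_space_distr[OF m(1)]]
      by (simp add: space_configurations)
  qed (auto simp: E_gen E_def cyl_def)
qed

text \<open>Counting shifted points in \<open>B\<close> is counting original points in
  \<open>B\<close> moved by \<open>t\<close>, and this motion preserves Borel sets, boundedness,
  volume and disjointness.\<close>

lemma poisson_translate:
  fixes N :: "'w \<Rightarrow> 'a::euclidean_space set"
  assumes N: "stationary_poisson_process M l N"
  shows "stationary_poisson_process M l (\<lambda>\<omega>. (\<lambda>y. y - t) ` N \<omega>)"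
proof -
  have card: "card ((\<lambda>y. y - t) ` P \<inter> B) = card (P \<inter> (+) t ` B)" for P B
  proof -
    have "(\<lambda>y. y - t) ` P \<inter> B = (\<lambda>y. y - t) ` (P \<inter> (+) t ` B)"
      by (force simp: image_iff)
    then show ?thesis by (simp add: card_image inj_on_def)
  qed
  have borel: "(+) t ` B \<in> sets borel" if "B \<in> sets borel" for B :: "'a set"
  proof -
    have "(\<lambda>x. x - t) -` B \<inter> space borel \<in> sets borel"
      using that by measurable
    moreover have "(\<lambda>x. x - t) -` B \<inter> space borel = (+) t ` B"
      by (force simp: image_iff)
    ultimately show ?thesis by simp
  qed
  have meas: "measure lborel ((+) t ` B) = measure lborel B" if "B \<in> sets borel" for B :: "'a set"
  proof -
    have "measure lborel ((+) t ` B) = measure (distr lborel borel ((+) t)) ((+) t ` B)"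
      by (simp add: lborel_distr_plus)
    also have "\<dots> = measure lborel ((+) t -` (+) t ` B)"
      using borel[OF that] by (subst measure_distr) auto
    also have "(+) t -` (+) t ` B = B" by (simp add: inj_vimage_image_eq)
    finally show ?thesis .
  qed
  have disj: "disjoint_family_on (\<lambda>i. (+) t ` C i) I" if "disjoint_family_on C I"
    for C :: "nat \<Rightarrow> 'a set" and I
    using that by (simp add: disjoint_family_on_def flip: image_Int)
  have fin: "finite ((\<lambda>y. y - t) ` N \<omega> \<inter> B)" if "\<omega> \<in> space M" "bounded B" for \<omega> B
    using locally_finite_translate[OF poisson_locally_finite[OF N that(1)]] that(2)
    by (simp add: locally_finite_def)
  have one: "(\<lambda>\<omega>. card (N \<omega> \<inter> (+) t ` B)) \<in> measurable M (count_space UNIV) \<and>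
      (\<forall>j. measure M {\<omega> \<in> space M. card (N \<omega> \<inter> (+) t ` B) = j} =
        (l * measure lborel B) ^ j / fact j * exp (- (l * measure lborel B)))"
    if B: "B \<in> sets borel \<and> bounded B" for B :: "'a set"
  proof -
    have tB: "(+) t ` B \<in> sets borel" "bounded ((+) t ` B)"
      using B by (simp_all add: borel bounded_translation)
    show ?thesis
      using poisson_measurable_card[OF N tB] poisson_card_prob[OF N tB] meas B by simp
  qed
  have indep: "prob_space.indep_vars M (\<lambda>_. count_space UNIV)
      (\<lambda>i \<omega>. card (N \<omega> \<inter> (+) t ` B i)) {..<m}"
    if "(\<forall>i<m. B i \<in> sets borel \<and> bounded (B i)) \<and> disjoint_family_on B {..<m}"
    for m and B :: "nat \<Rightarrow> 'a set"
    using that by (intro poisson_indep[OF N] borel bounded_translation disj) simp_all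
  show ?thesis
    unfolding stationary_poisson_process_def card
  proof (rule conjI)
    show "\<forall>\<omega>\<in>space M. \<forall>B. bounded B \<longrightarrow> finite ((\<lambda>y. y - t) ` N \<omega> \<inter> B)"
      using fin by blast
  next
    show "(\<forall>B. B \<in> sets borel \<and> bounded B \<longrightarrow>
        (\<lambda>\<omega>. card (N \<omega> \<inter> (+) t ` B)) \<in> measurable M (count_space UNIV) \<and>
        (\<forall>j. measure M {\<omega> \<in> space M. card (N \<omega> \<inter> (+) t ` B) = j} =
          (l * measure lborel B) ^ j / fact j * exp (- (l * measure lborel B)))) \<and>
      (\<forall>(m::nat) B. (\<forall>i<m. B i \<in> sets borel \<and> bounded (B i)) \<and> disjoint_family_on B {..<m} \<longrightarrow>
        prob_space.indep_vars M (\<lambda>_. count_space UNIV) (\<lambda>i \<omega>. card (N \<omega> \<inter> (+) t ` B i)) {..<m})"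
    proof (rule conjI; intro allI; rule impI)
      fix B :: "'a set"
      assume "B \<in> sets borel \<and> bounded B"
      from one[OF this]
      show "(\<lambda>\<omega>. card (N \<omega> \<inter> (+) t ` B)) \<in> measurable M (count_space UNIV) \<and>
        (\<forall>j. measure M {\<omega> \<in> space M. card (N \<omega> \<inter> (+) t ` B) = j} =
          (l * measure lborel B) ^ j / fact j * exp (- (l * measure lborel B)))" .
    next
      fix m :: nat and B :: "nat \<Rightarrow> 'a set"
      assume "(\<forall>i<m. B i \<in> sets borel \<and> bounded (B i)) \<and> disjoint_family_on B {..<m}"
      from indep[OF this] show "prob_space.indep_vars M (\<lambda>_. count_space UNIV)
        (\<lambda>i \<omega>. card (N \<omega> \<inter> (+) t ` B i)) {..<m}" .
    qed
  qed
qed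

text \<open>The process and its shift are both Poisson with the same intensity, so uniqueness of the
  law applies. This supplies the invariance on which \<open>mass_transport\<close> rests.\<close>

lemma poisson_law_translate:
  fixes N :: "'w \<Rightarrow> 'a::euclidean_space set"
  assumes "prob_space M" "stationary_poisson_process M l N"
  shows "distr (distr M configurations N) configurations (\<lambda>P. (\<lambda>y. y - t) ` P) =
    distr M configurations N"
proof -
  have "(\<lambda>P :: 'a set. (\<lambda>y. y - t) ` P) \<in> measurable configurations configurations"
    using measurable_compose[OF measurable_Pair1' measurable_translate_configurations, of t] by simp
  then have "distr (distr M configurations N) configurations (\<lambda>P. (\<lambda>y. y - t) ` P) =
      distr M configurations (\<lambda>\<omega>. (\<lambda>y. y - t) ` N \<omega>)"
    using poisson_measurable[OF assms(2)] by (subst distr_distr) (auto simp: comp_def)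
  also have "\<dots> = distr M configurations N"
    by (rule poisson_law_unique[OF assms(1,1) poisson_translate[OF assms(2)] assms(2)])
  finally show ?thesis .
qed

section \<open>Mass transport\<close>

lemma nn_integral_lborel_reflect:
  fixes f :: "'a::euclidean_space \<Rightarrow> ennreal"
  assumes [measurable]: "f \<in> borel_measurable borel"
  shows "(\<integral>\<^sup>+t. f (x - t) \<partial>lborel) = (\<integral>\<^sup>+t. f t \<partial>lborel)"
proof -
  have "lborel = distr lborel borel (\<lambda>t. x + (- 1) *\<^sub>R t :: 'a)"
    by (subst (1) lborel_affine[of "-1" x]) (simp_all add: density_1)
  then have "(\<integral>\<^sup>+t. f t \<partial>lborel) = (\<integral>\<^sup>+t. f t \<partial>distr lborel borel (\<lambda>t. x + (- 1) *\<^sub>R t))"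
    by simp
  also have "\<dots> = (\<integral>\<^sup>+t. f (x - t) \<partial>lborel)"
    by (subst nn_integral_distr) auto
  finally show ?thesis ..
qed

lemma nn_integral_lborel_translate:
  fixes f :: "'a::euclidean_space \<Rightarrow> ennreal"
  assumes [measurable]: "f \<in> borel_measurable borel"
  shows "(\<integral>\<^sup>+t. f (x + t) \<partial>lborel) = (\<integral>\<^sup>+t. f t \<partial>lborel)"
proof -
  have "(\<integral>\<^sup>+t. f t \<partial>lborel) = (\<integral>\<^sup>+t. f t \<partial>distr lborel borel ((+) x))"
    by (simp add: lborel_distr_plus)
  also have "\<dots> = (\<integral>\<^sup>+t. f (x + t) \<partial>lborel)"
    by (subst nn_integral_distr) auto
  finally show ?thesis ..
qed

text \<open>Later integrands evaluate \<open>G\<close> at a configuration recentred at one of its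
  points; here argument, shift and configuration may depend measurably on any further
  variables.\<close>

lemma measurable_translated_configuration:
  fixes G :: "'a::euclidean_space \<Rightarrow> 'a set \<Rightarrow> ennreal"
  assumes G: "(\<lambda>(s, P). G s P) \<in> borel_measurable (borel \<Otimes>\<^sub>M configurations)"
    and f: "f \<in> borel_measurable X" and h: "h \<in> borel_measurable X"
    and p: "p \<in> measurable X configurations"
  shows "(\<lambda>w. G (f w) ((\<lambda>y. y - h w) ` p w)) \<in> borel_measurable X"
  using measurable_compose[OF measurable_Pair[OF f
      measurable_compose[OF measurable_Pair[OF h p] measurable_translate_configurations]] G]
  by simp

text \<open>
  For each \<open>x\<close>, the shifts \<open>t\<close> with \<open>x - t \<in> A\<close> have volume \<open>vol A\<close>; stationarity then
  replaces the configuration by its shift by \<open>t\<close>, so that \<open>t\<close> is left only in the first argument of \<open>G\<close>.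
\<close>
lemma mass_transport:
  fixes Q :: "'a::euclidean_space set measure" and G :: "'a \<Rightarrow> 'a set \<Rightarrow> ennreal"
  assumes "prob_space Q" and sets_Q: "sets Q = sets configurations"
    and inv: "\<And>t. distr Q configurations (\<lambda>P. (\<lambda>y. y - t) ` P) = Q"
    and G: "(\<lambda>(s, P). G s P) \<in> borel_measurable (borel \<Otimes>\<^sub>M configurations)"
    and A[measurable]: "A \<in> sets borel"
  shows "emeasure lborel A * (\<integral>\<^sup>+P. \<integral>\<^sup>+x. G x ((\<lambda>y. y - x) ` P) \<partial>count_space P \<partial>Q) =
    (\<integral>\<^sup>+P. \<integral>\<^sup>+x. indicator A x * (\<integral>\<^sup>+s. G s ((\<lambda>y. y - x) ` P) \<partial>lborel) \<partial>count_space P \<partial>Q)"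
proof -
  interpret Q: prob_space Q by fact
  interpret QL: pair_sigma_finite lborel Q ..
  have space_Q: "space Q = Collect locally_finite"
    using sets_eq_imp_space_eq[OF sets_Q] by (simp add: space_configurations)
  have bm: "borel_measurable (lborel \<Otimes>\<^sub>M Q) = borel_measurable (borel \<Otimes>\<^sub>M configurations)"
    by (intro measurable_cong_sets sets_pair_measure_cong) (simp_all add: sets_Q)
  have bQ: "borel_measurable Q = borel_measurable configurations"
    by (intro measurable_cong_sets) (simp_all add: sets_Q)
  note GT = measurable_translated_configuration[OF G]
  have GTs[measurable]: "(\<lambda>t. G (f t) ((\<lambda>y. y - h t) ` P)) \<in> borel_measurable borel"
    if "P \<in> space Q" "f \<in> borel_measurable borel" "h \<in> borel_measurable borel"
    for f h :: "'a \<Rightarrow> 'a" and P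
    using that by (intro GT) (auto simp: space_Q space_configurations)
  \<comment> \<open>Integrated over \<open>t\<close>, \<open>W\<close> gives every point of
    \<open>P\<close> the weight \<open>vol A\<close>. \<open>V\<close> is the same sum after the
    configuration is shifted by \<open>t\<close>: a shifted point \<open>x\<close> has original
    position \<open>x + t\<close>, while the configuration seen from a point does not
    change.\<close>
  define W where "W t P = (\<integral>\<^sup>+x. indicator A (x - t) * G x ((\<lambda>y. y - x) ` P) \<partial>count_space P)" for t P
  define V where "V t P = (\<integral>\<^sup>+x. indicator A x * G (x + t) ((\<lambda>y. y - x) ` P) \<partial>count_space P)" for t P
  have W: "case_prod W \<in> borel_measurable (lborel \<Otimes>\<^sub>M Q)"
  proof -
    have "(\<lambda>(w :: 'a \<times> 'a set, x). indicator A (x - fst w) * G x ((\<lambda>y. y - x) ` snd w))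
        \<in> borel_measurable ((borel \<Otimes>\<^sub>M configurations) \<Otimes>\<^sub>M borel)"
      unfolding case_prod_beta by (intro borel_measurable_times_ennreal GT) measurable
    then show ?thesis
      unfolding bm W_def case_prod_beta
      by (intro measurable_nn_integral_points) (simp_all add: case_prod_beta)
  qed
  have V: "case_prod V \<in> borel_measurable (lborel \<Otimes>\<^sub>M Q)"
  proof -
    have "(\<lambda>(w :: 'a \<times> 'a set, x). indicator A x * G (x + fst w) ((\<lambda>y. y - x) ` snd w))
        \<in> borel_measurable ((borel \<Otimes>\<^sub>M configurations) \<Otimes>\<^sub>M borel)"
      unfolding case_prod_beta by (intro borel_measurable_times_ennreal GT) measurable
    then show ?thesis
      unfolding bm V_def case_prod_beta
      by (intro measurable_nn_integral_points) (simp_all add: case_prod_beta)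
  qed
  have WV: "W t P = V t ((\<lambda>y. y - t) ` P)" for t P
    unfolding W_def V_def nn_integral_translate_points
    by (simp add: image_image cong: image_cong_simp)
  have "(\<lambda>P. \<integral>\<^sup>+x. G x ((\<lambda>y. y - x) ` P) \<partial>count_space P) \<in> borel_measurable Q"
    unfolding bQ
    by (intro measurable_nn_integral_points) (unfold case_prod_beta, auto intro!: GT)
  then have "emeasure lborel A * (\<integral>\<^sup>+P. \<integral>\<^sup>+x. G x ((\<lambda>y. y - x) ` P) \<partial>count_space P \<partial>Q) =
      (\<integral>\<^sup>+P. emeasure lborel A * (\<integral>\<^sup>+x. G x ((\<lambda>y. y - x) ` P) \<partial>count_space P) \<partial>Q)"
    by (rule nn_integral_cmult[symmetric])
  also have "\<dots> = (\<integral>\<^sup>+P. \<integral>\<^sup>+t. W t P \<partial>lborel \<partial>Q)"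
  proof (rule nn_integral_cong)
    fix P assume "P \<in> space Q"
    then have "countable P" by (simp add: space_Q countable_locally_finite)
    then have "(\<integral>\<^sup>+t. W t P \<partial>lborel) =
        (\<integral>\<^sup>+x. \<integral>\<^sup>+t. indicator A (x - t) * G x ((\<lambda>y. y - x) ` P) \<partial>lborel \<partial>count_space P)"
      unfolding W_def by (intro nn_integral_count_space_nn_integral) auto
    also have "\<dots> = (\<integral>\<^sup>+x. emeasure lborel A * G x ((\<lambda>y. y - x) ` P) \<partial>count_space P)"
      by (intro nn_integral_cong, subst nn_integral_multc)
         (auto simp: nn_integral_lborel_reflect[where f = "indicator A"])
    finally show "emeasure lborel A * (\<integral>\<^sup>+x. G x ((\<lambda>y. y - x) ` P) \<partial>count_space P) =
        (\<integral>\<^sup>+t. W t P \<partial>lborel)"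
      by (simp add: nn_integral_cmult)
  qed
  also have "\<dots> = (\<integral>\<^sup>+t. \<integral>\<^sup>+P. W t P \<partial>Q \<partial>lborel)"
    by (rule QL.Fubini'[OF W])
  also have "\<dots> = (\<integral>\<^sup>+t. \<integral>\<^sup>+P. V t P \<partial>Q \<partial>lborel)"
  proof (rule nn_integral_cong)
    fix t :: 'a
    have tm: "(\<lambda>P. (\<lambda>y. y - t) ` P) \<in> measurable Q configurations"
      using measurable_compose[OF measurable_Pair1' measurable_translate_configurations, of t]
      by (simp add: measurable_cong_sets[OF sets_Q refl])
    have "V t \<in> borel_measurable configurations"
      using measurable_compose[OF measurable_Pair1' V, of t] by (simp add: bQ)
    then have "(\<integral>\<^sup>+P. V t P \<partial>distr Q configurations (\<lambda>P. (\<lambda>y. y - t) ` P)) = (\<integral>\<^sup>+P. W t P \<partial>Q)"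
      by (simp add: nn_integral_distr[OF tm] WV)
    then show "(\<integral>\<^sup>+P. W t P \<partial>Q) = (\<integral>\<^sup>+P. V t P \<partial>Q)"
      by (simp add: inv)
  qed
  also have "\<dots> = (\<integral>\<^sup>+P. \<integral>\<^sup>+t. V t P \<partial>lborel \<partial>Q)"
    by (rule QL.Fubini'[OF V, symmetric])
  also have "\<dots> = (\<integral>\<^sup>+P. \<integral>\<^sup>+x. indicator A x * (\<integral>\<^sup>+s. G s ((\<lambda>y. y - x) ` P) \<partial>lborel) \<partial>count_space P \<partial>Q)"
  proof (rule nn_integral_cong)
    fix P assume P: "P \<in> space Q"
    then have "countable P" by (simp add: space_Q countable_locally_finite)
    then have "(\<integral>\<^sup>+t. V t P \<partial>lborel) =
        (\<integral>\<^sup>+x. \<integral>\<^sup>+t. indicator A x * G (x + t) ((\<lambda>y. y - x) ` P) \<partial>lborel \<partial>count_space P)"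
      unfolding V_def by (intro nn_integral_count_space_nn_integral) (use P in auto)
    also have "\<dots> = (\<integral>\<^sup>+x. indicator A x * (\<integral>\<^sup>+t. G (x + t) ((\<lambda>y. y - x) ` P) \<partial>lborel) \<partial>count_space P)"
      using P by (intro nn_integral_cong nn_integral_cmult) auto
    also have "\<dots> = (\<integral>\<^sup>+x. indicator A x * (\<integral>\<^sup>+s. G s ((\<lambda>y. y - x) ` P) \<partial>lborel) \<partial>count_space P)"
      using P nn_integral_lborel_translate[OF GTs[OF P, of "\<lambda>x. x" "\<lambda>_. _"]]
      by (intro nn_integral_cong) simp
    finally show "(\<integral>\<^sup>+t. V t P \<partial>lborel) =
        (\<integral>\<^sup>+x. indicator A x * (\<integral>\<^sup>+s. G s ((\<lambda>y. y - x) ` P) \<partial>lborel) \<partial>count_space P)" .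
  qed
  finally show ?thesis .
qed

section \<open>Voronoi cells of a Poisson process\<close>

lemma closed_voronoi_cell: "closed (voronoi_cell x (P :: 'a::euclidean_space set))"
proof -
  have "voronoi_cell x P = (\<Inter>y\<in>P. {z. dist z x \<le> dist z y})"
    by (auto simp: voronoi_cell_def)
  also have "closed \<dots>"
    by (intro closed_INT ballI closed_Collect_le continuous_intros)
  finally show ?thesis .
qed

lemma borel_voronoi_cell[measurable]: "voronoi_cell x (P :: 'a::euclidean_space set) \<in> sets borel"
  by (rule borel_closed[OF closed_voronoi_cell])

lemma voronoi_cell_translate:
  fixes x :: "'a::euclidean_space"
  shows "(\<lambda>z. z - x) ` voronoi_cell x P = voronoi_cell 0 ((\<lambda>y. y - x) ` P)"
proof (intro subset_antisym subsetI)
  fix z assume z: "z \<in> voronoi_cell 0 ((\<lambda>y. y - x) ` P)"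
  then have "z + x \<in> voronoi_cell x P"
    by (auto simp: voronoi_cell_def dist_norm algebra_simps)
  then show "z \<in> (\<lambda>z. z - x) ` voronoi_cell x P"
    by (intro image_eqI[of _ _ "z + x"]) auto
qed (auto simp: voronoi_cell_def dist_norm)

text \<open>A point lies in its own cell at distance 0 from itself, so lying in the cell of
  \<open>y\<close> forces distance 0 to \<open>y\<close>. This lets \<open>cell_center\<close>
  recover the point from its cell.\<close>

lemma voronoi_cell_inject:
  assumes "x \<in> P" "y \<in> P" "voronoi_cell x P = voronoi_cell y P"
  shows "x = y"
proof -
  have "x \<in> voronoi_cell y P"
    unfolding assms(3)[symmetric] by (simp add: voronoi_cell_def)
  then have "dist x y \<le> dist x x"
    using assms(1) unfolding voronoi_cell_def by blast
  then show ?thesis by simp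
qed

text \<open>The origin lies in the cells of the points nearest to it. Local finiteness provides a
  nearest point and the absence of ties makes it unique; together with
  \<open>voronoi_cell_inject\<close> this resolves both definite descriptions.\<close>

lemma zero_cell_centered:
  fixes P :: "'a::euclidean_space set"
  assumes "locally_finite P" "P \<noteq> {}" and tie: "\<forall>x\<in>P. \<forall>y\<in>P. norm x = norm y \<longrightarrow> x = y"
  obtains x where "x \<in> P" "0 \<in> voronoi_cell x P"
    "(\<lambda>z. z - cell_center P (zero_cell P)) ` zero_cell P = voronoi_cell 0 ((\<lambda>y. y - x) ` P)"
proof -
  obtain y where y: "y \<in> P" using assms(2) by auto
  \<comment> \<open>Points farther out than the chosen \<open>y\<close> cannot be nearest, so the
    minimum may be sought in a finite set.\<close>
  define F where "F = P \<inter> cball 0 (norm y)"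
  have "finite F" "F \<noteq> {}"
    using assms(1) y by (auto simp: F_def locally_finite_def)
  then obtain x where x: "x \<in> F" "\<And>z. z \<in> F \<Longrightarrow> norm x \<le> norm z"
    using ex_min_if_finite[of "norm ` F"] by (auto simp: not_less)
  have "norm x \<le> norm z" if "z \<in> P" for z
    using x(2)[of z] x(1) that by (cases "norm z \<le> norm y") (auto simp: F_def)
  then have x0: "0 \<in> voronoi_cell x P" "x \<in> P"
    using x(1) by (auto simp: voronoi_cell_def F_def)
  have unique: "z = x" if "z \<in> P" "0 \<in> voronoi_cell z P" for z
  proof -
    have "norm z \<le> norm x" "norm x \<le> norm z"
      using that x0 by (auto simp: voronoi_cell_def)
    with tie that x0 show ?thesis by force
  qed
  have "zero_cell P = voronoi_cell x P"
    unfolding zero_cell_def voronoi_mosaic_def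
  proof (rule the_equality)
    fix C assume "C \<in> (\<lambda>x. voronoi_cell x P) ` P \<and> 0 \<in> C"
    then obtain z where "z \<in> P" "C = voronoi_cell z P" "0 \<in> C" by auto
    with unique[of z] show "C = voronoi_cell x P" by simp
  qed (use x0 in simp)
  moreover have "cell_center P (voronoi_cell x P) = x"
    unfolding cell_center_def
  proof (rule the_equality)
    fix z assume "z \<in> P \<and> voronoi_cell x P = voronoi_cell z P"
    then show "z = x" using x0(2) voronoi_cell_inject[of z P x] by simp
  qed (use x0 in simp)
  ultimately show thesis
    using that[of x] x0 by (simp add: voronoi_cell_translate)
qed

text \<open>A location \<open>z\<close> lies outside the cell exactly when some point of
  \<open>P\<close> is strictly closer to it than the origin. The number of such points is measurable
  in \<open>z\<close> and \<open>P\<close> jointly, and the indicator tests whether it is 0.\<close>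

lemma measurable_voronoi_indicator:
  "(\<lambda>(z, P). indicator (voronoi_cell 0 P) z :: ennreal) \<in>
    borel_measurable (borel \<Otimes>\<^sub>M (configurations :: 'a::euclidean_space set measure))"
proof -
  define c where "c w = (\<integral>\<^sup>+y. (if dist (fst w) y < dist (fst w) 0 then 1 else 0) \<partial>count_space (snd w))"
    for w :: "'a \<times> 'a set"
  have [measurable]: "c \<in> borel_measurable (borel \<Otimes>\<^sub>M configurations)"
    unfolding c_def by (intro measurable_nn_integral_points) measurable
  have "indicator (voronoi_cell 0 (snd w)) (fst w) = (if c w = 0 then 1 else 0 :: ennreal)" for w
  proof -
    have "c w = 0 \<longleftrightarrow> (\<forall>y\<in>snd w. \<not> dist (fst w) y < dist (fst w) 0)"
      unfolding c_def by (subst nn_integral_0_iff_AE) (auto simp: AE_count_space split: if_splits)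
    then show ?thesis by (simp add: indicator_def voronoi_cell_def not_less)
  qed
  then have "(\<lambda>(z, P). indicator (voronoi_cell 0 P) z :: ennreal) = (\<lambda>w. if c w = 0 then 1 else 0)"
    by (auto simp: case_prod_beta)
  then show ?thesis by simp
qed

lemma measurable_voronoi_volume:
  assumes [measurable]: "B \<in> sets borel"
  shows "(\<lambda>P. emeasure lborel (voronoi_cell 0 P \<inter> B)) \<in>
    borel_measurable (configurations :: 'a::euclidean_space set measure)"
proof -
  have "(\<lambda>(P, z). indicator B z * indicator (voronoi_cell 0 P) z :: ennreal)
      \<in> borel_measurable (configurations \<Otimes>\<^sub>M lborel)"
    using measurable_compose[OF _ measurable_voronoi_indicator, of "\<lambda>w. (snd w, fst w)" "configurations \<Otimes>\<^sub>M lborel"]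
    unfolding case_prod_beta by (intro borel_measurable_times_ennreal) auto
  from lborel.borel_measurable_nn_integral[OF this]
  show ?thesis
    by (simp add: nn_integral_indicator[symmetric] indicator_inter_arith mult.commute del: nn_integral_indicator)
qed

text \<open>When \<open>c\<close> is 0 or infinite the left side is 0, so only an inequality
  survives; it covers cells of degenerate volume.\<close>

lemma ennreal_mult_divide_le: "c * (v / c) \<le> (v :: ennreal)"
proof (cases "c = 0 \<or> c = top")
  case False
  then show ?thesis
    by (simp add: ennreal_times_divide mult_divide_eq_ennreal mult.commute[of c])
qed (auto simp: ennreal_divide_top)

text \<open>Expanding the squared norms turns the condition into the equation of the hyperplane
  through \<open>- y / 2\<close> orthogonal to \<open>y\<close>.\<close>

lemma null_equidistant:
  fixes y :: "'a::euclidean_space"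
  assumes "y \<noteq> 0"
  shows "emeasure lborel {s. norm (y + s) = norm s} = 0"
proof -
  have "{s. norm (y + s) = norm s} = {s. y \<bullet> s = - (y \<bullet> y) / 2}"
    by (auto simp: norm_eq inner_add_left inner_add_right inner_commute)
  then have "negligible {s. norm (y + s) = norm s}"
    using negligible_hyperplane[of y "- (y \<bullet> y) / 2"] assms by simp
  moreover have "{s. norm (y + s) = norm s} \<in> sets borel"
    by measurable
  ultimately show ?thesis
    by (auto simp: negligible_iff_null_sets null_sets_completion_iff)
qed

section \<open>Almost sure properties and expected counts of the process\<close>

locale poisson_point_process = prob_space M
  for M :: "'w measure" and l :: real and N :: "'w \<Rightarrow> 'a::euclidean_space set" +
  assumes intensity_pos: "0 < l"
    and poisson: "stationary_poisson_process M l N"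
begin

lemmas lf = poisson_locally_finite[OF poisson]
lemmas measurable_N[measurable] = poisson_measurable[OF poisson]
lemmas measurable_card = poisson_measurable_card[OF poisson]
lemmas card_prob = poisson_card_prob[OF poisson]

lemma nn_integral_process_eq:
  assumes "F \<in> borel_measurable configurations"
  shows "(\<integral>\<^sup>+\<omega>. F (N \<omega>) \<partial>M) = (\<integral>\<^sup>+P. F P \<partial>distr M configurations N)"
  using assms by (simp add: nn_integral_distr)

text \<open>\<open>mass_transport\<close> is applied to the law of \<open>N\<close>, whose
  invariance is \<open>poisson_law_translate\<close>; measurability of the two inner sums allows
  them to be integrated against that law.\<close>

lemma transport:
  assumes G: "(\<lambda>(s, P). G s P) \<in> borel_measurable (borel \<Otimes>\<^sub>M configurations)"
    and A: "A \<in> sets borel"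
  shows "emeasure lborel A * (\<integral>\<^sup>+\<omega>. \<integral>\<^sup>+x. G x ((\<lambda>y. y - x) ` N \<omega>) \<partial>count_space (N \<omega>) \<partial>M) =
    (\<integral>\<^sup>+\<omega>. \<integral>\<^sup>+x. indicator A x * (\<integral>\<^sup>+s. G s ((\<lambda>y. y - x) ` N \<omega>) \<partial>lborel) \<partial>count_space (N \<omega>) \<partial>M)"
proof -
  note GT = measurable_translated_configuration[OF G]
  have [measurable]: "A \<in> sets borel" by fact
  have m1: "(\<lambda>P. \<integral>\<^sup>+x. G x ((\<lambda>y. y - x) ` P) \<partial>count_space P) \<in> borel_measurable configurations"
    by (intro measurable_nn_integral_points) (unfold case_prod_beta, auto intro!: GT)
  have "(\<lambda>w :: ('a set \<times> 'a) \<times> 'a. G (snd w) ((\<lambda>y. y - snd (fst w)) ` fst (fst w)))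
      \<in> borel_measurable ((configurations \<Otimes>\<^sub>M borel) \<Otimes>\<^sub>M lborel)"
    by (intro GT) measurable
  then have "(\<lambda>w :: 'a set \<times> 'a. \<integral>\<^sup>+s. G s ((\<lambda>y. y - snd w) ` fst w) \<partial>lborel)
      \<in> borel_measurable (configurations \<Otimes>\<^sub>M borel)"
    by (intro lborel.borel_measurable_nn_integral) (simp add: case_prod_beta)
  then have m2: "(\<lambda>P. \<integral>\<^sup>+x. indicator A x * (\<integral>\<^sup>+s. G s ((\<lambda>y. y - x) ` P) \<partial>lborel) \<partial>count_space P)
      \<in> borel_measurable configurations"
    by (intro measurable_nn_integral_points)
       (unfold case_prod_beta, auto intro!: borel_measurable_times_ennreal)
  show ?thesis
    unfolding nn_integral_process_eq[OF m1] nn_integral_process_eq[OF m2]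
    by (rule mass_transport[OF prob_space_distr[OF measurable_N] _
          poisson_law_translate[OF prob_space_axioms poisson] G A]) simp
qed

text \<open>Evaluated at a point \<open>x\<close> and the configuration seen from \<open>x\<close>,
  \<open>G\<close> counts the other points with the same norm as \<open>x\<close>, so the sum over
  \<open>x\<close> counts ordered tied pairs. After transport the position \<open>s\<close> ranges
  over the whole space while the differences stay fixed, and ties then occur only on null
  hyperplanes.\<close>

lemma AE_no_ties: "AE \<omega> in M. \<forall>x\<in>N \<omega>. \<forall>y\<in>N \<omega>. norm x = norm y \<longrightarrow> x = y"
proof -
  define tie where "tie s y = (if y \<noteq> 0 \<and> norm (y + s) = norm s then 1 else 0 :: ennreal)" for s y :: 'a
  define G where "G s P = (\<integral>\<^sup>+y. tie s y \<partial>count_space P)" for s and P :: "'a set"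
  have [measurable]: "tie s \<in> borel_measurable borel" "(\<lambda>s. tie s y) \<in> borel_measurable borel" for s y
    unfolding tie_def by measurable
  have G: "(\<lambda>(s, P). G s P) \<in> borel_measurable (borel \<Otimes>\<^sub>M configurations)"
    unfolding G_def case_prod_beta tie_def by (intro measurable_nn_integral_points) measurable
  have tie0: "(\<integral>\<^sup>+s. tie s y \<partial>lborel) = 0" for y
  proof (cases "y = 0")
    case False
    then have "(\<integral>\<^sup>+s. tie s y \<partial>lborel) = (\<integral>\<^sup>+s. indicator {s. norm (y + s) = norm s} s \<partial>lborel)"
      by (intro nn_integral_cong) (simp add: tie_def indicator_def)
    also have "\<dots> = 0"
      using null_equidistant[OF False] by (subst nn_integral_indicator) auto
    finally show ?thesis .
  qed (simp add: tie_def)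
  have "(\<integral>\<^sup>+s. G s ((\<lambda>y. y - x) ` N \<omega>) \<partial>lborel) = 0" if "\<omega> \<in> space M" for \<omega> x
  proof -
    have "(\<integral>\<^sup>+s. G s ((\<lambda>y. y - x) ` N \<omega>) \<partial>lborel) =
        (\<integral>\<^sup>+y. \<integral>\<^sup>+s. tie s y \<partial>lborel \<partial>count_space ((\<lambda>y. y - x) ` N \<omega>))"
      unfolding G_def using countable_locally_finite[OF lf[OF that]]
      by (intro nn_integral_count_space_nn_integral) auto
    then show ?thesis by (simp add: tie0)
  qed
  then have "(\<integral>\<^sup>+\<omega>. \<integral>\<^sup>+x. indicator (ball 0 1) x * (\<integral>\<^sup>+s. G s ((\<lambda>y. y - x) ` N \<omega>) \<partial>lborel)
      \<partial>count_space (N \<omega>) \<partial>M) = (\<integral>\<^sup>+\<omega>. 0 \<partial>M)"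
    by (intro nn_integral_cong) simp
  \<comment> \<open>The unit ball has positive volume, so this factor can be cancelled.\<close>
  then have "(\<integral>\<^sup>+\<omega>. \<integral>\<^sup>+x. G x ((\<lambda>y. y - x) ` N \<omega>) \<partial>count_space (N \<omega>) \<partial>M) = 0"
    using transport[OF G, of "ball 0 1"] unit_ball_vol_pos[of "real DIM('a)", THEN less_imp_neq]
    by (auto simp: emeasure_ball)
  moreover have "(\<lambda>\<omega>. \<integral>\<^sup>+x. G x ((\<lambda>y. y - x) ` N \<omega>) \<partial>count_space (N \<omega>)) \<in> borel_measurable M"
    by (intro measurable_nn_integral_points)
       (unfold case_prod_beta, auto intro!: measurable_translated_configuration[OF G])
  ultimately have "AE \<omega> in M. (\<integral>\<^sup>+x. G x ((\<lambda>y. y - x) ` N \<omega>) \<partial>count_space (N \<omega>)) = 0"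
    by (subst (asm) nn_integral_0_iff_AE)
  then show ?thesis
  proof (rule AE_mp, intro AE_I2 impI ballI)
    fix \<omega> x y
    assume 0: "(\<integral>\<^sup>+x. G x ((\<lambda>y. y - x) ` N \<omega>) \<partial>count_space (N \<omega>)) = 0"
      and xy: "x \<in> N \<omega>" "y \<in> N \<omega>" "norm x = norm y"
    from 0 xy(1) have "G x ((\<lambda>y. y - x) ` N \<omega>) = 0"
      by (subst (asm) nn_integral_0_iff_AE) (auto simp: AE_count_space)
    then have "tie x (y - x) = 0"
      using xy(2) unfolding G_def by (subst (asm) nn_integral_0_iff_AE) (auto simp: AE_count_space)
    then show "x = y" using xy(3) by (auto simp: tie_def split: if_splits)
  qed
qed

text \<open>An empty process leaves every centered ball void, and the void probabilities tend to 0
  as the radius grows.\<close>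

lemma AE_nonempty: "AE \<omega> in M. N \<omega> \<noteq> {}"
proof -
  define c where "c = l * unit_ball_vol (DIM('a))"
  have "0 < c" using intensity_pos unit_ball_vol_pos[of "real DIM('a)"] by (simp add: c_def)
  define Z where "Z r = {\<omega>\<in>space M. card (N \<omega> \<inter> ball 0 (real r)) = 0}" for r :: nat
  have Z: "Z r \<in> sets M" for r
  proof -
    have "(\<lambda>\<omega>. card (N \<omega> \<inter> ball 0 (real r))) -` {0} \<inter> space M \<in> sets M"
      by (rule measurable_sets[OF measurable_card]) auto
    also have "(\<lambda>\<omega>. card (N \<omega> \<inter> ball 0 (real r))) -` {0} \<inter> space M = Z r"
      by (auto simp: Z_def)
    finally show ?thesis .
  qed
  have "prob (Z r) \<le> exp (- c * real r)" if "0 < r" for r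
  proof -
    have "prob (Z r) = exp (- (c * real r ^ DIM('a)))"
      unfolding Z_def using card_prob[of "ball 0 (real r)" 0]
      by (simp add: content_ball c_def)
    \<comment> \<open>For \<open>r\<close> at least 1 the exponent can be weakened to a linear one,
      whose limit is handled in all dimensions at once.\<close>
    moreover have "real r ^ 1 \<le> real r ^ DIM('a)"
      using that DIM_positive[where 'a = 'a] by (intro power_increasing) auto
    ultimately show ?thesis using \<open>0 < c\<close> by simp
  qed
  moreover have "prob (\<Inter>r. Z r) \<le> prob (Z r)" for r
    by (intro finite_measure_mono Z) auto
  ultimately have le: "prob (\<Inter>r. Z r) \<le> exp (- c * real r)" if "0 < r" for r
    using that order.trans by blast
  have "(\<lambda>r. exp (- c * real r)) \<longlonglongrightarrow> 0"
    using \<open>0 < c\<close> by real_asymp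
  then have "prob (\<Inter>r. Z r) \<le> 0"
    by (rule LIMSEQ_le_const) (use le in \<open>auto intro!: exI[of _ 1]\<close>)
  then have "emeasure M (\<Inter>r. Z r) = 0"
    by (simp add: emeasure_eq_measure measure_le_0_iff)
  moreover have "(\<Inter>r. Z r) \<in> sets M" using Z by blast
  ultimately show ?thesis
    by (intro AE_I[of _ _ "\<Inter>r. Z r"]) (auto simp: Z_def)
qed

lemma expectation_card:
  assumes A: "A \<in> sets borel" "bounded A"
  shows "(\<integral>\<^sup>+\<omega>. of_nat (card (N \<omega> \<inter> A)) \<partial>M) = ennreal (l * measure lborel A)"
proof -
  define a where "a = l * measure lborel A"
  have "0 \<le> a" using intensity_pos by (simp add: a_def)
  define p where "p j = a ^ j / fact j * exp (- a)" for j
  have p0: "0 \<le> p j" for j using \<open>0 \<le> a\<close> by (simp add: p_def)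
  have d: "distr M (count_space UNIV) (\<lambda>\<omega>. card (N \<omega> \<inter> A)) = density (count_space UNIV) p"
  proof (rule measure_eqI_countable[where A = UNIV])
    fix j :: nat
    have "(\<lambda>\<omega>. card (N \<omega> \<inter> A)) -` {j} \<inter> space M = {\<omega>\<in>space M. card (N \<omega> \<inter> A) = j}" by auto
    then show "emeasure (distr M (count_space UNIV) (\<lambda>\<omega>. card (N \<omega> \<inter> A))) {j} =
        emeasure (density (count_space UNIV) p) {j}"
      using card_prob[OF A, of j]
      by (simp add: emeasure_distr[OF measurable_card[OF A]] emeasure_eq_measure emeasure_density
          p_def a_def nn_integral_count_space_indicator[symmetric])
  qed auto
  \<comment> \<open>Cancelling \<open>j\<close> against the factorial leaves
    \<open>a * exp (- a)\<close> times the exponential series, shifted by one index because the term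
    at 0 vanishes.\<close>
  have "(\<lambda>j. real j * p j) sums a"
  proof -
    have "(\<lambda>j. a * exp (- a) * (a ^ j /\<^sub>R fact j)) sums (a * exp (- a) * exp a)"
      by (intro sums_mult exp_converges)
    moreover have "a * exp (- a) * exp a = a" by (simp add: exp_minus)
    moreover have "a * exp (- a) * (a ^ j /\<^sub>R fact j) = real (Suc j) * p (Suc j)" for j
      by (simp add: p_def divide_simps)
    ultimately have "(\<lambda>j. real (Suc j) * p (Suc j)) sums a" by simp
    then show ?thesis
      by (subst (asm) sums_Suc_iff) simp
  qed
  then have s: "(\<Sum>j. ennreal (real j * p j)) = ennreal a"
    using p0 by (intro suminf_ennreal_eq) auto
  have "(\<integral>\<^sup>+\<omega>. of_nat (card (N \<omega> \<inter> A)) \<partial>M) =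
      (\<integral>\<^sup>+j. of_nat j \<partial>distr M (count_space UNIV) (\<lambda>\<omega>. card (N \<omega> \<inter> A)))"
    by (simp add: nn_integral_distr[OF measurable_card[OF A]])
  also have "\<dots> = (\<Sum>j. ennreal (real j * p j))"
    unfolding d using p0
    by (subst nn_integral_density)
       (auto simp: nn_integral_count_space_nat ennreal_mult ennreal_of_nat_eq_real_of_nat mult.commute)
  finally show ?thesis by (simp add: s a_def)
qed

text \<open>Independence over disjoint sets separates the mean count from the void probability. In
  \<open>void_bound\<close> this factorisation takes the place of the Mecke formula.\<close>

lemma expectation_card_void:
  assumes A: "A \<in> sets borel" "bounded A" and C: "C \<in> sets borel" "bounded C" and "A \<inter> C = {}"
  shows "(\<integral>\<^sup>+\<omega>. of_nat (card (N \<omega> \<inter> A)) * indicator {0} (card (N \<omega> \<inter> C)) \<partial>M) =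
    ennreal (l * measure lborel A) * ennreal (exp (- (l * measure lborel C)))"
proof -
  define D where "D i = (if i = 0 then A else C)" for i :: nat
  define \<phi> where "\<phi> i = (if i = 0 then of_nat else indicator {0} :: nat \<Rightarrow> ennreal)" for i :: nat
  have "indep_vars (\<lambda>_. count_space UNIV) (\<lambda>i \<omega>. card (N \<omega> \<inter> D i)) {..<2}"
    by (rule poisson_indep[OF poisson])
       (use assms in \<open>auto simp: D_def disjoint_family_on_def\<close>)
  then have "indep_vars (\<lambda>_. borel) (\<lambda>i \<omega>. \<phi> i (card (N \<omega> \<inter> D i))) {..<2}"
    by (rule indep_vars_compose2) simp
  from indep_vars_nn_integral[OF _ this]
  have "(\<integral>\<^sup>+\<omega>. of_nat (card (N \<omega> \<inter> A)) * indicator {0} (card (N \<omega> \<inter> C)) \<partial>M) =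
      (\<integral>\<^sup>+\<omega>. of_nat (card (N \<omega> \<inter> A)) \<partial>M) * (\<integral>\<^sup>+\<omega>. indicator {0} (card (N \<omega> \<inter> C)) \<partial>M)"
    by (simp add: \<phi>_def D_def numeral_2_eq_2 lessThan_Suc mult.commute)
  also have "(\<integral>\<^sup>+\<omega>. indicator {0} (card (N \<omega> \<inter> C)) \<partial>M) =
      (\<integral>\<^sup>+\<omega>. indicator {\<omega>\<in>space M. card (N \<omega> \<inter> C) = 0} \<omega> \<partial>M)"
    by (intro nn_integral_cong) (simp add: indicator_def)
  also have "\<dots> = emeasure M {\<omega>\<in>space M. card (N \<omega> \<inter> C) = 0}"
  proof (rule nn_integral_indicator)
    have "(\<lambda>\<omega>. card (N \<omega> \<inter> C)) -` {0} \<inter> space M \<in> sets M"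
      by (rule measurable_sets[OF measurable_card[OF C]]) auto
    also have "(\<lambda>\<omega>. card (N \<omega> \<inter> C)) -` {0} \<inter> space M = {\<omega>\<in>space M. card (N \<omega> \<inter> C) = 0}"
      by auto
    finally show "{\<omega>\<in>space M. card (N \<omega> \<inter> C) = 0} \<in> sets M" .
  qed
  also have "\<dots> = ennreal (exp (- (l * measure lborel C)))"
    using card_prob[OF C, of 0] by (simp add: emeasure_eq_measure)
  finally show ?thesis by (simp add: expectation_card[OF A])
qed

end

section \<open>Upper bound for the law of the uniform point\<close>

context poisson_point_process
begin

text \<open>If \<open>x\<close> is within \<open>e\<close> of the origin, any point \<open>y\<close>
  closer to \<open>z\<close> than \<open>norm z - e\<close> satisfies
  \<open>dist z (y - x) < norm z\<close> and so excludes \<open>z\<close> from the cell. The ball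
  about \<open>z\<close> misses the ball about 0, so count and void event factorise. Truncating
  \<open>r\<close> at 0 makes the ball about \<open>z\<close> empty when \<open>norm z\<close> is at
  most \<open>e\<close>; the void event is then certain.\<close>

lemma void_bound:
  fixes z :: 'a
  assumes "0 < e"
  defines "r \<equiv> max 0 (norm z - e)"
  shows "(\<integral>\<^sup>+\<omega>. \<integral>\<^sup>+x. indicator (ball 0 e) x * indicator (voronoi_cell 0 ((\<lambda>y. y - x) ` N \<omega>)) z
      \<partial>count_space (N \<omega>) \<partial>M) \<le>
    emeasure lborel (ball (0::'a) e) *
      ennreal (l * exp (- (l * unit_ball_vol (DIM('a)) * r ^ DIM('a))))"
    (is "?I \<le> _")
proof -
  have "?I \<le> (\<integral>\<^sup>+\<omega>. of_nat (card (N \<omega> \<inter> ball 0 e)) * indicator {0} (card (N \<omega> \<inter> ball z r)) \<partial>M)"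
  proof (rule nn_integral_mono)
    fix \<omega> assume \<omega>: "\<omega> \<in> space M"
    let ?J = "\<integral>\<^sup>+x. indicator (ball 0 e) x * indicator (voronoi_cell 0 ((\<lambda>y. y - x) ` N \<omega>)) z
      \<partial>count_space (N \<omega>) :: ennreal"
    show "?J \<le> of_nat (card (N \<omega> \<inter> ball 0 e)) * indicator {0} (card (N \<omega> \<inter> ball z r))"
    proof (cases "N \<omega> \<inter> ball z r = {}")
      case True
      have "?J \<le> (\<integral>\<^sup>+x. indicator (ball 0 e) x \<partial>count_space (N \<omega>))"
        by (intro nn_integral_mono) (simp add: indicator_def)
      also have "\<dots> = of_nat (card (N \<omega> \<inter> ball 0 e))"
        by (intro nn_integral_indicator_points locally_finite_ball lf \<omega>)
      finally show ?thesis using True by simp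
    next
      case False
      then obtain y where y: "y \<in> N \<omega>" "dist z y < r" by auto
      have "z \<notin> voronoi_cell 0 ((\<lambda>y. y - x) ` N \<omega>)" if "x \<in> ball 0 e" for x
      proof
        assume "z \<in> voronoi_cell 0 ((\<lambda>y. y - x) ` N \<omega>)"
        then have "norm z \<le> dist z (y - x)"
          using y(1) by (auto simp: voronoi_cell_def)
        also have "\<dots> \<le> dist z y + norm x"
          using norm_triangle_ineq[of "z - y" x] by (simp add: dist_norm algebra_simps)
        finally show False
          using y(2) that zero_le_dist[of z y] by (auto simp: r_def max_def split: if_splits)
      qed
      then have "?J = (\<integral>\<^sup>+x. 0 \<partial>count_space (N \<omega>))"
        by (intro nn_integral_cong) (auto simp: indicator_def)
      then show ?thesis by simp
    qed
  qed
  also have "\<dots> = ennreal (l * measure lborel (ball (0::'a) e)) * ennreal (exp (- (l * measure lborel (ball z r))))"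
  proof (rule expectation_card_void)
    have False if "norm x < e" "dist z x < r" for x
      using that norm_triangle_ineq[of "z - x" x] zero_le_dist[of z x]
      by (auto simp: r_def dist_norm max_def split: if_splits)
    then show "ball 0 e \<inter> ball z r = {}" by auto
  qed auto
  also have "\<dots> = emeasure lborel (ball (0::'a) e) *
      ennreal (l * exp (- (l * unit_ball_vol (DIM('a)) * r ^ DIM('a))))"
    using assms intensity_pos
    by (simp add: content_ball emeasure_ball ennreal_mult[symmetric] mult_ac)
  finally show ?thesis .
qed

text \<open>Transport to the ball of radius \<open>e\<close> replaces \<open>- x\<close> by an
  integration variable. By reflection its indicator integrates to the cell volume, which cancels the
  denominator and leaves the volume of the cell inside \<open>B\<close>. The volume of the ball,
  positive and finite, is divided out at the end.\<close>

lemma cell_bound: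
  assumes B[measurable]: "B \<in> sets borel" and "0 < e"
  shows "(\<integral>\<^sup>+\<omega>. \<integral>\<^sup>+x. indicator (voronoi_cell 0 ((\<lambda>y. y - x) ` N \<omega>)) (- x) *
        (emeasure lborel (voronoi_cell 0 ((\<lambda>y. y - x) ` N \<omega>) \<inter> B) /
         emeasure lborel (voronoi_cell 0 ((\<lambda>y. y - x) ` N \<omega>))) \<partial>count_space (N \<omega>) \<partial>M) \<le>
    (\<integral>\<^sup>+z. indicator B z *
        ennreal (l * exp (- (l * unit_ball_vol (DIM('a)) * max 0 (norm z - e) ^ DIM('a)))) \<partial>lborel)"
    (is "?I \<le> ?R")
proof -
  interpret LM: pair_sigma_finite lborel M ..
  define vol where "vol P = emeasure lborel (voronoi_cell 0 P)" for P :: "'a set"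
  define volB where "volB P = emeasure lborel (voronoi_cell 0 P \<inter> B)" for P
  \<comment> \<open>At \<open>s = x\<close> the indicator asks whether the origin lies in the cell
    of \<open>x\<close>, read in coordinates centered at \<open>x\<close>.\<close>
  define G where "G s P = indicator (voronoi_cell 0 P) (- s) * (volB P / vol P)" for s P
  let ?A = "ball (0::'a) e"
  have [measurable]: "vol \<in> borel_measurable configurations" "volB \<in> borel_measurable configurations"
    unfolding vol_def volB_def
    using measurable_voronoi_volume[of UNIV] measurable_voronoi_volume[OF B] by simp_all
  have VI: "(\<lambda>w. indicator (voronoi_cell 0 (p w)) (h w) :: ennreal) \<in> borel_measurable X"
    if "p \<in> measurable X configurations" "h \<in> borel_measurable X" for X p and h :: "_ \<Rightarrow> 'a"
    using measurable_compose[OF measurable_Pair[OF that(2,1)] measurable_voronoi_indicator] by simp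
  have VI2: "(\<lambda>w. indicator (voronoi_cell 0 ((\<lambda>y. y - k w) ` p w)) (h w) :: ennreal) \<in> borel_measurable X"
    if "p \<in> measurable X configurations" "h \<in> borel_measurable X" "k \<in> borel_measurable X"
    for X p and h k :: "_ \<Rightarrow> 'a"
    using measurable_translated_configuration[OF measurable_voronoi_indicator that(2,3,1)] .
  have G: "(\<lambda>(s, P). G s P) \<in> borel_measurable (borel \<Otimes>\<^sub>M configurations)"
    unfolding G_def case_prod_beta
    by (intro borel_measurable_times_ennreal borel_measurable_divide_ennreal VI) measurable
  \<comment> \<open>Writing the volume inside \<open>B\<close> as an integral over \<open>z\<close>
    reduces the expectation to one fixed \<open>z\<close> at a time, where \<open>void_bound\<close>
    applies.\<close>
  define H where "H z \<omega> = (\<integral>\<^sup>+x. indicator ?A x *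
      (indicator B z * indicator (voronoi_cell 0 ((\<lambda>y. y - x) ` N \<omega>)) z) \<partial>count_space (N \<omega>))" for z \<omega>
  have IA: "(\<lambda>w. indicator ?A (snd w) :: ennreal) \<in> borel_measurable ((lborel \<Otimes>\<^sub>M M) \<Otimes>\<^sub>M borel)"
    by (rule measurable_compose[OF measurable_snd borel_measurable_indicator]) simp
  have H: "case_prod H \<in> borel_measurable (lborel \<Otimes>\<^sub>M M)"
    unfolding H_def case_prod_beta
    by (intro measurable_nn_integral_points)
       (unfold case_prod_beta, auto intro!: borel_measurable_times_ennreal VI2 IA)
  have "emeasure lborel ?A * ?I =
      (\<integral>\<^sup>+\<omega>. \<integral>\<^sup>+x. indicator ?A x * (\<integral>\<^sup>+s. G s ((\<lambda>y. y - x) ` N \<omega>) \<partial>lborel) \<partial>count_space (N \<omega>) \<partial>M)"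
    using transport[OF G, of ?A] by (simp add: G_def vol_def volB_def)
  also have "\<dots> \<le> (\<integral>\<^sup>+\<omega>. \<integral>\<^sup>+x. indicator ?A x * volB ((\<lambda>y. y - x) ` N \<omega>) \<partial>count_space (N \<omega>) \<partial>M)"
  proof (intro nn_integral_mono mult_left_mono)
    fix \<omega> x
    let ?P = "(\<lambda>y. y - x) ` N \<omega>"
    have "(\<integral>\<^sup>+s. G s ?P \<partial>lborel) = (\<integral>\<^sup>+s. indicator (voronoi_cell 0 ?P) (- s) \<partial>lborel) * (volB ?P / vol ?P)"
      unfolding G_def by (rule nn_integral_multc) measurable
    also have "(\<integral>\<^sup>+s. indicator (voronoi_cell 0 ?P) (- s) \<partial>lborel) = vol ?P"
      using nn_integral_lborel_reflect[of "indicator (voronoi_cell 0 ?P)" 0] by (simp add: vol_def)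
    finally show "(\<integral>\<^sup>+s. G s ?P \<partial>lborel) \<le> volB ?P"
      by (simp add: ennreal_mult_divide_le)
  qed simp
  also have "\<dots> = (\<integral>\<^sup>+\<omega>. \<integral>\<^sup>+z. H z \<omega> \<partial>lborel \<partial>M)"
  proof (rule nn_integral_cong)
    fix \<omega> assume \<omega>: "\<omega> \<in> space M"
    have "(\<integral>\<^sup>+z. H z \<omega> \<partial>lborel) = (\<integral>\<^sup>+x. \<integral>\<^sup>+z. indicator ?A x *
      (indicator B z * indicator (voronoi_cell 0 ((\<lambda>y. y - x) ` N \<omega>)) z) \<partial>lborel \<partial>count_space (N \<omega>))"
      unfolding H_def by (intro nn_integral_count_space_nn_integral countable_locally_finite lf \<omega>) measurable
    also have "\<dots> = (\<integral>\<^sup>+x. indicator ?A x * volB ((\<lambda>y. y - x) ` N \<omega>) \<partial>count_space (N \<omega>))"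
      by (intro nn_integral_cong, subst nn_integral_cmult)
         (auto simp: volB_def indicator_inter_arith mult.commute simp flip: nn_integral_indicator)
    finally show "(\<integral>\<^sup>+x. indicator ?A x * volB ((\<lambda>y. y - x) ` N \<omega>) \<partial>count_space (N \<omega>)) =
        (\<integral>\<^sup>+z. H z \<omega> \<partial>lborel)" ..
  qed
  also have "\<dots> = (\<integral>\<^sup>+z. \<integral>\<^sup>+\<omega>. H z \<omega> \<partial>M \<partial>lborel)"
    by (rule LM.Fubini'[OF H])
  also have "\<dots> \<le> (\<integral>\<^sup>+z. emeasure lborel ?A * (indicator B z *
      ennreal (l * exp (- (l * unit_ball_vol (DIM('a)) * max 0 (norm z - e) ^ DIM('a))))) \<partial>lborel)"
  proof (rule nn_integral_mono)
    fix z :: 'a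
    show "(\<integral>\<^sup>+\<omega>. H z \<omega> \<partial>M) \<le> emeasure lborel ?A * (indicator B z *
      ennreal (l * exp (- (l * unit_ball_vol (DIM('a)) * max 0 (norm z - e) ^ DIM('a)))))"
      using void_bound[OF \<open>0 < e\<close>, of z] by (cases "z \<in> B") (simp_all add: H_def)
  qed
  also have "\<dots> = emeasure lborel ?A * ?R"
    by (rule nn_integral_cmult) measurable
  finally have "emeasure lborel ?A * ?I \<le> emeasure lborel ?A * ?R" .
  moreover have "0 < emeasure lborel ?A" "emeasure lborel ?A < top"
    using \<open>0 < e\<close> unit_ball_vol_pos[of "real DIM('a)"]
    by (simp_all add: emeasure_ball)
  ultimately show ?thesis
    by (simp add: ennreal_mult_le_mult_iff)
qed

lemma subalgebra_process: "subalgebra M (process_algebra M N)"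
proof -
  let ?E = "{{\<omega>\<in>space M. card (N \<omega> \<inter> B) = j} | B (j::nat). B \<in> sets borel \<and> bounded B}"
  have "{\<omega>\<in>space M. card (N \<omega> \<inter> B) = j} \<in> sets M" if "B \<in> sets borel" "bounded B" for B and j :: nat
  proof -
    have "(\<lambda>\<omega>. card (N \<omega> \<inter> B)) -` {j} \<inter> space M \<in> sets M"
      by (rule measurable_sets[OF measurable_card[OF that]]) auto
    also have "(\<lambda>\<omega>. card (N \<omega> \<inter> B)) -` {j} \<inter> space M = {\<omega>\<in>space M. card (N \<omega> \<inter> B) = j}" by auto
    finally show ?thesis .
  qed
  then have "?E \<subseteq> sets M" by blast
  moreover have "?E \<subseteq> Pow (space M)" by auto
  ultimately show ?thesis
    unfolding subalgebra_def process_algebra_def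
    by (simp add: space_measure_of sets_measure_of sets.sigma_sets_subset)
qed

text \<open>The expectation of the conditional probability is the law of \<open>Y\<close>. Almost
  surely the zero cell has a single center \<open>x\<close>, and the conditional probability is then
  at most the summand at \<open>x\<close>, hence at most the sum over all points.\<close>

lemma conditionally_uniform_le:
  assumes Y: "conditionally_uniform M (process_algebra M N) Y
      (\<lambda>\<omega>. (\<lambda>z. z - cell_center (N \<omega>) (zero_cell (N \<omega>))) ` zero_cell (N \<omega>))"
    and B[measurable]: "B \<in> sets borel"
  shows "emeasure (distr M borel Y) B \<le>
    (\<integral>\<^sup>+\<omega>. \<integral>\<^sup>+x. indicator (voronoi_cell 0 ((\<lambda>y. y - x) ` N \<omega>)) (- x) *
        (emeasure lborel (voronoi_cell 0 ((\<lambda>y. y - x) ` N \<omega>) \<inter> B) /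
         emeasure lborel (voronoi_cell 0 ((\<lambda>y. y - x) ` N \<omega>))) \<partial>count_space (N \<omega>) \<partial>M)"
proof -
  define S where "S \<omega> = (\<lambda>z. z - cell_center (N \<omega>) (zero_cell (N \<omega>))) ` zero_cell (N \<omega>)" for \<omega>
  interpret F: sigma_finite_subalgebra M "process_algebra M N"
    by (intro finite_measure_subalgebra_is_sigma_finite)
       (simp add: finite_measure_subalgebra_def finite_measure_subalgebra_axioms_def
         subalgebra_process finite_measure_axioms)
  have [measurable]: "Y \<in> borel_measurable M"
    using Y by (simp add: conditionally_uniform_def)
  let ?f = "indicat_real (Y -` B \<inter> space M)"
  let ?c = "real_cond_exp M (process_algebra M N) ?f"
  have c: "AE \<omega> in M. ?c \<omega> = measure (uniform_measure lborel (S \<omega>)) B"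
    using Y B by (simp add: conditionally_uniform_def S_def)
  have int: "integrable M ?f"
    by (intro integrable_real_indicator) (auto simp: emeasure_eq_measure)
  have "emeasure (distr M borel Y) B = ennreal (\<integral>\<omega>. ?f \<omega> \<partial>M)"
    by (simp add: emeasure_distr emeasure_eq_measure)
  also have "(\<integral>\<omega>. ?f \<omega> \<partial>M) = (\<integral>\<omega>. ?c \<omega> \<partial>M)"
    by (rule F.real_cond_exp_int(2)[OF int, symmetric])
  also have "ennreal \<dots> = (\<integral>\<^sup>+\<omega>. ?c \<omega> \<partial>M)"
    by (intro nn_integral_eq_integral[symmetric] F.real_cond_exp_int(1)[OF int] F.real_cond_exp_pos)
       auto
  also have "\<dots> \<le> (\<integral>\<^sup>+\<omega>. \<integral>\<^sup>+x. indicator (voronoi_cell 0 ((\<lambda>y. y - x) ` N \<omega>)) (- x) *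
        (emeasure lborel (voronoi_cell 0 ((\<lambda>y. y - x) ` N \<omega>) \<inter> B) /
         emeasure lborel (voronoi_cell 0 ((\<lambda>y. y - x) ` N \<omega>))) \<partial>count_space (N \<omega>) \<partial>M)"
  proof (rule nn_integral_mono_AE)
    show "AE \<omega> in M. ennreal (?c \<omega>) \<le> (\<integral>\<^sup>+x. indicator (voronoi_cell 0 ((\<lambda>y. y - x) ` N \<omega>)) (- x) *
        (emeasure lborel (voronoi_cell 0 ((\<lambda>y. y - x) ` N \<omega>) \<inter> B) /
         emeasure lborel (voronoi_cell 0 ((\<lambda>y. y - x) ` N \<omega>))) \<partial>count_space (N \<omega>))"
      using c AE_no_ties AE_nonempty AE_space
    proof eventually_elim
      fix \<omega>
      let ?K = "\<lambda>x. voronoi_cell 0 ((\<lambda>y. y - x) ` N \<omega>)"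
      assume c: "?c \<omega> = measure (uniform_measure lborel (S \<omega>)) B"
        and \<omega>: "\<forall>x\<in>N \<omega>. \<forall>y\<in>N \<omega>. norm x = norm y \<longrightarrow> x = y" "N \<omega> \<noteq> {}" "\<omega> \<in> space M"
      obtain x where x: "x \<in> N \<omega>" "0 \<in> voronoi_cell x (N \<omega>)" "S \<omega> = ?K x"
        using zero_cell_centered[OF lf[OF \<omega>(3)] \<omega>(2,1)] unfolding S_def by blast
      \<comment> \<open>Recentring at \<open>x\<close> carries the origin, which lies in the cell of
        \<open>x\<close>, to \<open>- x\<close>.\<close>
      have "- x \<in> ?K x"
        unfolding voronoi_cell_translate[symmetric] using x(2) by (intro image_eqI[of _ _ 0]) auto
      \<comment> \<open>\<open>measure\<close> sends the value infinity to 0, so passing to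
        \<open>emeasure\<close> can only increase.\<close>
      have "ennreal (?c \<omega>) \<le> emeasure (uniform_measure lborel (S \<omega>)) B"
        unfolding c measure_def by (cases "emeasure (uniform_measure lborel (S \<omega>)) B") auto
      also have "\<dots> = indicator (?K x) (- x) * (emeasure lborel (?K x \<inter> B) / emeasure lborel (?K x))"
        using \<open>- x \<in> ?K x\<close> by (simp add: x(3))
      also have "\<dots> \<le> (\<integral>\<^sup>+x. indicator (?K x) (- x) *
          (emeasure lborel (?K x \<inter> B) / emeasure lborel (?K x)) \<partial>count_space (N \<omega>))"
        by (rule nn_integral_ge_point[OF x(1)])
      finally show "ennreal (?c \<omega>) \<le> (\<integral>\<^sup>+x. indicator (?K x) (- x) *
          (emeasure lborel (?K x \<inter> B) / emeasure lborel (?K x)) \<partial>count_space (N \<omega>))" .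
    qed
  qed
  finally show ?thesis .
qed

end

section \<open>Radial integrals and log-concavity\<close>

lemma vimage_norm_power_atMost:
  fixes s c :: real
  assumes "0 < c" "0 < n" "0 \<le> s"
  shows "{x :: 'a::real_normed_vector. c * norm x ^ n \<le> s} = cball 0 (root n (s / c))"
proof (intro set_eqI)
  fix x :: 'a
  have "c * norm x ^ n \<le> s \<longleftrightarrow> norm x ^ n \<le> s / c"
    using assms by (simp add: field_simps)
  also have "\<dots> \<longleftrightarrow> root n (norm x ^ n) \<le> root n (s / c)"
    using assms by simp
  also have "root n (norm x ^ n) = norm x"
    using assms by (simp add: real_root_power_cancel)
  finally show "x \<in> {x. c * norm x ^ n \<le> s} \<longleftrightarrow> x \<in> cball 0 (root n (s / c))" by simp
qed

text \<open>
  The volume of the centered ball through \<open>x\<close>, as a function of \<open>x\<close>, has Lebesgue measure on the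
  half-line as its law; this replaces polar coordinates.
\<close>
lemma nn_integral_lborel_ball_volume:
  fixes g :: "real \<Rightarrow> ennreal"
  assumes [measurable]: "g \<in> borel_measurable borel"
  shows "(\<integral>\<^sup>+x. g (unit_ball_vol (DIM('a)) * norm x ^ DIM('a)) \<partial>(lborel :: 'a::euclidean_space measure)) =
    (\<integral>\<^sup>+t. indicator {0..} t * g t \<partial>lborel)"
proof -
  let ?c = "unit_ball_vol (DIM('a))"
  let ?v = "\<lambda>x :: 'a. ?c * norm x ^ DIM('a)"
  have c: "0 < ?c" by simp
  have eq: "distr lborel borel ?v = density lborel (indicator {0..})"
  \<comment> \<open>On the half-line up to \<open>s\<close> both measures equal
    \<open>max 0 s\<close>: for nonnegative \<open>s\<close> the sublevel set is the centered ball
    of volume \<open>s\<close>.\<close>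
  proof (rule measure_eqI_generator_eq[where E = "range atMost" and \<Omega> = UNIV and A = "\<lambda>n::nat. {..real n}"])
    show "Int_stable (range (atMost :: real \<Rightarrow> real set))"
    proof (rule Int_stableI)
      fix a b :: "real set" assume "a \<in> range atMost" "b \<in> range atMost"
      then obtain x y where "a = {..x}" "b = {..y}" by auto
      then have "a \<inter> b = {..min x y}" by auto
      then show "a \<inter> b \<in> range atMost" by blast
    qed
    fix X :: "real set" assume "X \<in> range atMost"
    then obtain s where X: "X = {..s}" by auto
    have L: "emeasure (distr lborel borel ?v) X = emeasure lborel {x. ?v x \<le> s}"
      unfolding X by (subst emeasure_distr) (auto intro!: arg_cong2[where f = emeasure])
    have R: "emeasure (density lborel (indicator {0..})) X = emeasure lborel ({0..} \<inter> {..s})"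
      unfolding X by (subst emeasure_density) (simp_all flip: indicator_inter_arith)
    show "emeasure (distr lborel borel ?v) X = emeasure (density lborel (indicator {0..})) X"
    proof (cases "0 \<le> s")
      case True
      have "emeasure lborel {x. ?v x \<le> s} = ennreal (?c * root DIM('a) (s / ?c) ^ DIM('a))"
        using True c by (simp add: vimage_norm_power_atMost emeasure_cball)
      also have "?c * root DIM('a) (s / ?c) ^ DIM('a) = s"
        using True c by (simp add: less_imp_neq[OF c, symmetric])
      finally show ?thesis unfolding L R using True by (simp add: atLeastAtMost_def[symmetric])
    next
      case False
      have "0 \<le> ?v x" for x :: 'a using c by (intro mult_nonneg_nonneg) auto
      then have "{x. ?v x \<le> s} = {}" using False by (auto simp: not_le intro: less_le_trans)
      moreover have "{0..} \<inter> {..s} = {}" using False by auto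
      ultimately show ?thesis unfolding L R by simp
    qed
  next
    show "sets (distr lborel borel ?v) = sigma_sets UNIV (range atMost)"
      by (simp add: borel_eq_atMost)
    show "sets (density lborel (indicator {0..})) = sigma_sets UNIV (range (atMost :: real \<Rightarrow> _))"
      by (simp add: borel_eq_atMost)
    show "(\<Union>n::nat. {..real n}) = UNIV" using real_arch_simple by auto
    fix n :: nat
    have "emeasure (distr lborel borel ?v) {..real n} = emeasure lborel {x. ?v x \<le> real n}"
      by (subst emeasure_distr) (auto intro!: arg_cong2[where f = emeasure])
    also have "\<dots> \<noteq> \<infinity>"
      using c by (simp add: vimage_norm_power_atMost emeasure_cball)
    finally show "emeasure (distr lborel borel ?v) {..real n} \<noteq> \<infinity>" .
  qed auto
  have "(\<integral>\<^sup>+x. g (?v x) \<partial>lborel) = (\<integral>\<^sup>+t. g t \<partial>distr lborel borel ?v)"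
    by (subst nn_integral_distr) auto
  also have "\<dots> = (\<integral>\<^sup>+t. indicator {0..} t * g t \<partial>lborel)"
    unfolding eq by (subst nn_integral_density) auto
  finally show ?thesis .
qed

text \<open>In terms of the ball volume \<open>t\<close> the norm is a root of \<open>t / c\<close>,
  and rescaling by \<open>l\<close> produces Euler's integral for the Gamma function. The case
  \<open>k = 0\<close> also gives the total mass 1 of the density.\<close>

lemma radial_moment:
  fixes l :: real and k :: nat
  assumes "0 < l"
  shows "(\<integral>\<^sup>+x. ennreal (norm x ^ k *
        (l * exp (- (l * unit_ball_vol (DIM('a)) * norm x ^ DIM('a))))) \<partial>(lborel :: 'a::euclidean_space measure)) =
    ennreal (Gamma (1 + real k / real DIM('a)) /
      (l * unit_ball_vol (DIM('a))) powr (real k / real DIM('a)))"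
proof -
  define c where "c = unit_ball_vol (DIM('a))"
  define q where "q = real k / real DIM('a)"
  have c: "0 < c" and q: "0 \<le> q" by (simp_all add: c_def q_def)
  let ?g = "\<lambda>t. ennreal (root DIM('a) (t / c) ^ k * (l * exp (- (l * t))))"
  have "(\<integral>\<^sup>+x. ennreal (norm x ^ k * (l * exp (- (l * c * norm x ^ DIM('a))))) \<partial>(lborel :: 'a measure)) =
      (\<integral>\<^sup>+x. ?g (unit_ball_vol (DIM('a)) * norm x ^ DIM('a)) \<partial>(lborel :: 'a measure))"
    using c by (intro nn_integral_cong)
       (simp add: c_def[symmetric] real_root_power_cancel mult.assoc)
  also have "\<dots> = (\<integral>\<^sup>+t. indicator {0..} t * ?g t \<partial>lborel)"
    by (rule nn_integral_lborel_ball_volume) measurable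
  finally have 1: "(\<integral>\<^sup>+x. ennreal (norm x ^ k * (l * exp (- (l * c * norm x ^ DIM('a))))) \<partial>(lborel :: 'a measure)) =
      (\<integral>\<^sup>+t. indicator {0..} t * ?g t \<partial>lborel)" .
  have "ennreal (Gamma (1 + q)) = (\<integral>\<^sup>+t. ennreal (indicator {0..} t * t powr q / exp t) \<partial>lborel)"
    using Gamma_conv_nn_integral_real[of "1 + q"] q by simp
  also have "\<dots> = ennreal l * (\<integral>\<^sup>+t. ennreal (indicator {0..} (l * t) * (l * t) powr q / exp (l * t)) \<partial>lborel)"
    using assms by (subst nn_integral_real_affine[of _ l 0]) auto
  also have "\<dots> = (\<integral>\<^sup>+t. ennreal l * ennreal (indicator {0..} (l * t) * (l * t) powr q / exp (l * t)) \<partial>lborel)"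
    by (rule nn_integral_cmult[symmetric]) measurable
  also have "\<dots> = (\<integral>\<^sup>+t. ennreal ((l * c) powr q) * (indicator {0..} t * ?g t) \<partial>lborel)"
  proof (rule nn_integral_cong_AE)
    \<comment> \<open>For \<open>k = 0\<close> the two sides differ at \<open>t = 0\<close>, since
      \<open>0 powr 0\<close> is 0 while a zeroth power is 1; this point is removed as a null
      set.\<close>
    have "AE t in lborel. t \<noteq> (0::real)" by (rule AE_lborel_singleton)
    then show "AE t in lborel. ennreal l * ennreal (indicator {0..} (l * t) * (l * t) powr q / exp (l * t)) =
        ennreal ((l * c) powr q) * (indicator {0..} t * ?g t)"
    proof eventually_elim
      fix t :: real assume "t \<noteq> 0"
      show "ennreal l * ennreal (indicator {0..} (l * t) * (l * t) powr q / exp (l * t)) =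
        ennreal ((l * c) powr q) * (indicator {0..} t * ?g t)"
      proof (cases "0 < t")
        case True
        have "root DIM('a) (t / c) ^ k = (t / c) powr q"
          using True c by (simp add: root_powr_inverse q_def powr_powr flip: powr_realpow)
        moreover have "(l * t) powr q = (l * c) powr q * (t / c) powr q"
          using True c assms by (simp flip: powr_mult)
        ultimately show ?thesis
          using True assms by (simp add: exp_minus field_simps flip: ennreal_mult)
      next
        case False
        with \<open>t \<noteq> 0\<close> have "t < 0" by simp
        with assms have "l * t < 0" by (simp add: mult_pos_neg)
        with \<open>t < 0\<close> show ?thesis by (simp add: indicator_def)
      qed
    qed
  qed
  also have "\<dots> = ennreal ((l * c) powr q) * (\<integral>\<^sup>+t. indicator {0..} t * ?g t \<partial>lborel)"
    by (rule nn_integral_cmult) measurable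
  finally have 2: "ennreal (Gamma (1 + q)) = ennreal ((l * c) powr q) * (\<integral>\<^sup>+t. indicator {0..} t * ?g t \<partial>lborel)" .
  have p: "0 < (l * c) powr q" using assms c by simp
  have "ennreal (Gamma (1 + q) / (l * c) powr q) = ennreal (Gamma (1 + q)) / ennreal ((l * c) powr q)"
    using p q by (intro divide_ennreal[symmetric] less_imp_le Gamma_real_pos) auto
  also have "\<dots> = (\<integral>\<^sup>+t. indicator {0..} t * ?g t \<partial>lborel)"
    unfolding 2 using p by (simp add: mult.commute[of "ennreal ((l * c) powr q)"] mult_divide_eq_ennreal)
  finally show ?thesis
    unfolding 1[unfolded c_def] c_def q_def by simp
qed

text \<open>The power is convex and increasing on the nonnegative reals, so composing it with the
  convex norm keeps convexity. The function is positive everywhere, hence its logarithm is examined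
  on the whole space.\<close>

lemma log_concave_exp_neg_norm_power:
  fixes a b :: real
  assumes "0 < a" "0 \<le> b" "0 < n"
  shows "log_concave (\<lambda>x :: 'a::real_normed_vector. a * exp (- (b * norm x ^ n)))"
proof -
  \<comment> \<open>Even powers are convex on the whole line, odd ones in general only on the
    half-line, which is where norms take their values.\<close>
  have pow: "convex_on {0::real..} (\<lambda>x. x ^ n)"
    by (cases "even n") (auto intro: convex_power_odd convex_on_subset[OF convex_power_even])
  have "convex_on UNIV (\<lambda>x :: 'a. norm x ^ n)"
  proof (rule convex_onI)
    fix t :: real and x y :: 'a assume t: "0 < t" "t < 1"
    have "norm ((1 - t) *\<^sub>R x + t *\<^sub>R y) \<le> (1 - t) * norm x + t * norm y"
      using t by (intro order.trans[OF norm_triangle_ineq]) simp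
    then have "norm ((1 - t) *\<^sub>R x + t *\<^sub>R y) ^ n \<le> ((1 - t) * norm x + t * norm y) ^ n"
      by (intro power_mono) auto
    also have "\<dots> \<le> (1 - t) * norm x ^ n + t * norm y ^ n"
      using convex_onD[OF pow, of t "norm x" "norm y"] t by simp
    finally show "norm ((1 - t) *\<^sub>R x + t *\<^sub>R y) ^ n \<le> (1 - t) * norm x ^ n + t * norm y ^ n" .
  qed simp
  then have "convex_on UNIV (\<lambda>x :: 'a. b * norm x ^ n - ln a)"
    using assms by (intro convex_on_diff convex_on_cmul concave_on_const[THEN iffD2]) simp_all
  then have "concave_on UNIV (\<lambda>x :: 'a. - (b * norm x ^ n - ln a))"
    by (simp add: concave_on_def)
  moreover have "ln (a * exp (- (b * norm x ^ n))) = - (b * norm x ^ n - ln a)" for x :: 'a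
    using assms by (simp add: ln_mult)
  ultimately show ?thesis
    using assms by (simp add: log_concave_def)
qed

text \<open>Applied to the complement, the inequality reverses on the set itself, because both total
  masses are 1.\<close>

lemma (in prob_space) measure_eq_of_le:
  assumes "prob_space K" and sets: "sets K = sets M"
    and le: "\<And>B. B \<in> sets M \<Longrightarrow> emeasure M B \<le> emeasure K B"
  shows "M = K"
proof (rule measure_eqI)
  interpret K: prob_space K by fact
  note sp = sets_eq_imp_space_eq[OF sets]
  fix B assume B: "B \<in> sets M"
  have le': "prob C \<le> K.prob C" if "C \<in> sets M" for C
    using le[OF that] by (simp add: emeasure_eq_measure K.emeasure_eq_measure)
  have "1 - prob B \<le> 1 - K.prob B"
    using le'[of "space M - B"] B K.prob_compl[of B] by (simp add: prob_compl sets sp)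
  with le'[OF B] show "emeasure M B = emeasure K B"
    by (simp add: emeasure_eq_measure K.emeasure_eq_measure)
qed (use sets in simp)

section \<open>The law of the uniform point of the centered zero cell\<close>

context poisson_point_process
begin

text \<open>Letting \<open>e\<close> tend to 0 in \<open>cell_bound\<close> bounds the law by the
  density, and \<open>measure_eq_of_le\<close> upgrades this to equality. Bounded sets come first,
  since there the constant \<open>l\<close> is an integrable majorant; exhaustion by balls gives the
  rest.\<close>

lemma distributed_centered_zero_cell:
  fixes Y :: "'w \<Rightarrow> 'a"
  assumes Y: "conditionally_uniform M (process_algebra M N) Y
      (\<lambda>\<omega>. (\<lambda>z. z - cell_center (N \<omega>) (zero_cell (N \<omega>))) ` zero_cell (N \<omega>))"
  shows "distributed M lborel Y
    (\<lambda>z. ennreal (l * exp (- (l * unit_ball_vol (DIM('a)) * norm z ^ DIM('a)))))"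
proof -
  define f where "f r = ennreal (l * exp (- (l * unit_ball_vol (DIM('a)) * r ^ DIM('a))))" for r :: real
  have f[measurable]: "f \<in> borel_measurable borel" unfolding f_def by measurable
  have Ym[measurable]: "Y \<in> borel_measurable M"
    using Y by (simp add: conditionally_uniform_def)
  have bounded_le: "emeasure (distr M borel Y) B \<le> (\<integral>\<^sup>+z. indicator B z * f (norm z) \<partial>lborel)"
    if B[measurable]: "B \<in> sets borel" and "bounded B" for B
  proof -
    define e where "e m = inverse (real (Suc m))" for m
    have e: "e \<longlonglongrightarrow> 0" unfolding e_def by (rule LIMSEQ_inverse_real_of_nat)
    have "(\<lambda>m. \<integral>\<^sup>+z. indicator B z * f (max 0 (norm z - e m)) \<partial>lborel) \<longlonglongrightarrow>
        (\<integral>\<^sup>+z. indicator B z * f (norm z) \<partial>lborel)"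
    proof (rule nn_integral_dominated_convergence)
      show "AE z in lborel. indicator B z * f (max 0 (norm z - e m)) \<le> ennreal l * indicator B z" for m
        using intensity_pos by (intro AE_I2) (auto simp: f_def indicator_def intro!: ennreal_leI)
      have "(\<integral>\<^sup>+z. ennreal l * indicator B z \<partial>lborel) = ennreal l * emeasure lborel B"
        by (simp add: nn_integral_cmult)
      also have "\<dots> < \<infinity>"
        using emeasure_bounded_finite[OF \<open>bounded B\<close>] by (simp add: ennreal_mult_less_top)
      finally show "(\<integral>\<^sup>+z. ennreal l * indicator B z \<partial>lborel) < \<infinity>" .
      show "AE z in lborel. (\<lambda>m. indicator B z * f (max 0 (norm z - e m))) \<longlonglongrightarrow> indicator B z * f (norm z)"
      proof (intro AE_I2)
        fix z :: 'a
        have "(\<lambda>m. max 0 (norm z - e m)) \<longlonglongrightarrow> max 0 (norm z - 0)"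
          by (intro tendsto_intros e)
        then have "(\<lambda>m. f (max 0 (norm z - e m))) \<longlonglongrightarrow> f (norm z)"
          unfolding f_def by (intro tendsto_intros) simp
        then show "(\<lambda>m. indicator B z * f (max 0 (norm z - e m))) \<longlonglongrightarrow> indicator B z * f (norm z)"
          by (cases "z \<in> B") simp_all
      qed
    qed measurable
    moreover have "emeasure (distr M borel Y) B \<le> (\<integral>\<^sup>+z. indicator B z * f (max 0 (norm z - e m)) \<partial>lborel)" for m
      unfolding f_def by (rule order.trans[OF conditionally_uniform_le[OF Y B] cell_bound[OF B]]) (simp add: e_def)
    ultimately show ?thesis by (intro LIMSEQ_le_const) auto
  qed
  have "distr M borel Y = density lborel (\<lambda>z. f (norm z))"
  proof (rule prob_space.measure_eq_of_le)
    show "prob_space (distr M borel Y)" by (rule prob_space_distr) measurable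
    show "prob_space (density lborel (\<lambda>z :: 'a. f (norm z)))"
    proof
      \<comment> \<open>The total mass is the moment of order 0, namely \<open>Gamma 1\<close>,
        which is 1.\<close>
      show "emeasure (density lborel (\<lambda>z :: 'a. f (norm z))) (space (density lborel (\<lambda>z :: 'a. f (norm z)))) = 1"
        using radial_moment[OF intensity_pos, where k = 0 and 'a = 'a] unit_ball_vol_pos[of "real DIM('a)", THEN less_imp_neq] intensity_pos
        by (auto simp: emeasure_density f_def)
    qed
    fix B assume "B \<in> sets (distr M borel Y)"
    then have [measurable]: "B \<in> sets borel" by simp
    let ?B = "\<lambda>r::nat. B \<inter> ball 0 (real r)"
    have "emeasure (distr M borel Y) B = (SUP r. emeasure (distr M borel Y) (?B r))"
    proof -
      have "B = (\<Union>r. ?B r)" using UN_ball_nat by blast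
      then show ?thesis
        by (subst SUP_emeasure_incseq) (auto simp: incseq_def)
    qed
    also have "\<dots> \<le> (\<integral>\<^sup>+z. indicator B z * f (norm z) \<partial>lborel)"
    proof (rule SUP_least)
      fix r
      have "emeasure (distr M borel Y) (?B r) \<le> (\<integral>\<^sup>+z. indicator (?B r) z * f (norm z) \<partial>lborel)"
        by (rule bounded_le) auto
      also have "\<dots> \<le> (\<integral>\<^sup>+z. indicator B z * f (norm z) \<partial>lborel)"
        by (intro nn_integral_mono) (auto simp: indicator_def)
      finally show "emeasure (distr M borel Y) (?B r) \<le> (\<integral>\<^sup>+z. indicator B z * f (norm z) \<partial>lborel)" .
    qed
    also have "\<dots> = emeasure (density lborel (\<lambda>z. f (norm z))) B"
      by (simp add: emeasure_density mult.commute)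
    finally show "emeasure (distr M borel Y) B \<le> emeasure (density lborel (\<lambda>z. f (norm z))) B" .
  qed simp
  then show ?thesis
    unfolding distributed_def f_def by (simp cong: distr_cong)
qed

end

section \<open>Density, log-concavity and moments\<close>

theorem proposition3p1:
  fixes M :: "'w measure"
    and l :: real
    and N :: "'w \<Rightarrow> (real ^ 'n::finite) set"
    and Y :: "'w \<Rightarrow> real ^ 'n"
    and f :: "real ^ 'n \<Rightarrow> real"
  defines "f \<equiv> \<lambda>x. l * exp (- l * unit_ball_vol (real CARD('n)) * norm x ^ CARD('n))"
  assumes "prob_space M"
    and "0 < l"
    and "stationary_poisson_process M l N"
    and "conditionally_uniform M (process_algebra M N) Y
           (\<lambda>\<omega>. (\<lambda>z. z - cell_center (N \<omega>) (zero_cell (N \<omega>))) ` zero_cell (N \<omega>))"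
  shows "distributed M lborel Y (\<lambda>x. ennreal (f x)) \<and> log_concave f \<and>
         (\<forall>k::nat. integrable M (\<lambda>\<omega>. norm (Y \<omega>) ^ k) \<and>
            prob_space.expectation M (\<lambda>\<omega>. norm (Y \<omega>) ^ k) =
              Gamma (1 + real k / real CARD('n)) /
              (l * unit_ball_vol (real CARD('n))) powr (real k / real CARD('n)))"
proof -
  let ?n = "CARD('n)" and ?c = "unit_ball_vol (real CARD('n))"
  interpret poisson_point_process M l N
    using assms by (simp add: poisson_point_process_def poisson_point_process_axioms_def)
  have f: "f = (\<lambda>x. l * exp (- (l * ?c * norm x ^ ?n)))"
    by (simp add: f_def)
  have d: "distributed M lborel Y (\<lambda>x. ennreal (f x))"
    using distributed_centered_zero_cell[OF assms(5)] by (simp add: f)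
  have "log_concave f"
    unfolding f using \<open>0 < l\<close> by (intro log_concave_exp_neg_norm_power) auto
  moreover have "integrable M (\<lambda>\<omega>. norm (Y \<omega>) ^ k) \<and>
      expectation (\<lambda>\<omega>. norm (Y \<omega>) ^ k) =
        Gamma (1 + real k / real ?n) / (l * ?c) powr (real k / real ?n)" for k :: nat
  proof -
    have Y[measurable]: "Y \<in> borel_measurable M"
      using distributed_measurable[OF d] by simp
    have "(\<integral>\<^sup>+\<omega>. ennreal (norm (Y \<omega>) ^ k) \<partial>M) = (\<integral>\<^sup>+x. ennreal (f x) * ennreal (norm x ^ k) \<partial>lborel)"
      by (rule distributed_nn_integral[OF d, symmetric]) measurable
    also have "\<dots> = (\<integral>\<^sup>+x. ennreal (norm x ^ k * (l * exp (- (l * ?c * norm x ^ ?n))))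
        \<partial>(lborel :: (real ^ 'n) measure))"
      using \<open>0 < l\<close> by (intro nn_integral_cong) (simp add: f mult.commute flip: ennreal_mult)
    also have "\<dots> = ennreal (Gamma (1 + real k / real ?n) / (l * ?c) powr (real k / real ?n))"
      using radial_moment[OF \<open>0 < l\<close>, of k, where 'a = "real ^ 'n"] by simp
    finally have I: "(\<integral>\<^sup>+\<omega>. ennreal (norm (Y \<omega>) ^ k) \<partial>M) =
        ennreal (Gamma (1 + real k / real ?n) / (l * ?c) powr (real k / real ?n))" .
    \<comment> \<open>Powers of the norm and the claimed value are nonnegative, so the extended
      integral yields integrability together with the expectation.\<close>
    have "0 < Gamma (1 + real k / real ?n)"
      by (intro Gamma_real_pos) (simp add: add_pos_nonneg)
    then have "has_bochner_integral M (\<lambda>\<omega>. norm (Y \<omega>) ^ k)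
        (Gamma (1 + real k / real ?n) / (l * ?c) powr (real k / real ?n))"
      by (intro has_bochner_integral_nn_integral I) auto
    then show ?thesis
      by (simp add: has_bochner_integral_iff)
  qed
  ultimately show ?thesis using d by blast
qed

end
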